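(* There exist a compact metrizable space $X$ and a homeomorphism $T:X\to X$ such that the cascade $(X,T)$ is minimal and PI (of order $3$), and its enveloping semigroup $E(X,T)$ has exactly $2^{\mathfrak{c}}$ minimal left ideals, where $\mathfrak{c}=2^{\aleph_0}$.
   Context: A cascade $(X,T)$ is a compact space $X$ with a homeomorphism $T$, regarded as a flow of the acting group $G=\mathbb{Z}$ via $n\cdot x=T^nx$. More generally a flow $(X,G)$ is a compact Hausdorff space $X$ with a continuous homomorphism of a topological group $G$ into $\mathrm{Homeo}(X)$, written $(g,x)\mapsto gx$. It is minimal if every orbit $Gx$ is dense in $X$. A homomorphism of flows is a continuous $G$-equivariant map (automatically surjective when the target is minimal); one also calls it an extension of its target. Enveloping semigroup: $E(X,G)$ is the closure in $X^X$ (product topology) of the set of maps $\{x\mapsto gx : g\in G\}$ (so $E(X,T)$ is the closure of $\{T^n:n\in\mathbb{Z}\}$); it is a semigroup under composition. A left ideal is a nonempty subset $I\subset E(X,G)$ with $E(X,G)\,I\subset I$; it is minimal if it contains no strictly smaller left ideal. Two points $x_1,x_2$ of a flow are proximal if there is a net $g_i\in G$ with $\lim g_ix_1=\lim g_ix_2$. An extension $\phi:W'\to W$ is proximal if any two points with the same image under $\phi$ are proximal. It is equicontinuous if, with $R_\phi=\{(a,b)\in W'\times W':\phi(a)=\phi(b)\}$, for every neighborhood $\alpha$ of the diagonal in $W'\times W'$ there is a neighborhood $\beta$ of the diagonal such that $(ga,gb)\in\alpha$ for all $g\in G$ and all $(a,b)\in\beta\cap R_\phi$ (for metrizable minimal flows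 such extensions are also called isometric). A minimal flow $(X,G)$ is strictly PI if there are an ordinal $\eta$ and a family of minimal flows $\{W_\iota\}_{\iota\le\eta}$ such that: $W_0$ is the trivial (one-point) flow; for every $\iota<\eta$ there is a homomorphism $\phi_\iota:W_{\iota+1}\to W_\iota$ which is either proximal or equicontinuous; for every limit ordinal $\nu\le\eta$, $W_\nu$ is the inverse limit of $\{W_\iota\}_{\iota<\nu}$; and $W_\eta=X$. A minimal flow $(X,G)$ is a PI-flow if there exist a strictly PI flow $\tilde X$ and a proximal homomorphism $\theta:\tilde X\to X$. "PI of order $n$" ($n\in\mathbb{N}$) means: strictly PI via such a tower of length $\eta=n$, i.e. obtained from the trivial flow by $n$ successive extensions, each non-trivial (not an isomorphism) and each either proximal or equicontinuous. *)

theory Defs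
  imports "HOL-Analysis.Analysis" "HOL-Library.Equipollence"
begin

text \<open>
  Flows are taken for the acting group of integers only. A flow is then a cascade \<open>(X, T)\<close>:
  a compact Hausdorff topology \<open>X\<close> on a set of elements of type \<open>'a\<close>, and a map \<open>T\<close> that is a
  homeomorphism of \<open>X\<close>. The values of \<open>T\<close> outside \<open>topspace X\<close> are irrelevant.
\<close>

definition cascade :: "'a topology \<Rightarrow> ('a \<Rightarrow> 'a) \<Rightarrow> bool" where
  "cascade X T \<longleftrightarrow> compact_space X \<and> Hausdorff_space X \<and> homeomorphic_map X X T"

definition zpow :: "'a topology \<Rightarrow> ('a \<Rightarrow> 'a) \<Rightarrow> int \<Rightarrow> 'a \<Rightarrow> 'a" where
  "zpow X T n = (if 0 \<le> n then T ^^ nat n else inv_into (topspace X) T ^^ nat (- n))"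

text \<open>A minimal flow is nonempty, so that homomorphisms onto minimal flows are surjective.\<close>

definition minimal_cascade :: "'a topology \<Rightarrow> ('a \<Rightarrow> 'a) \<Rightarrow> bool" where
  "minimal_cascade X T \<longleftrightarrow> cascade X T \<and> topspace X \<noteq> {} \<and>
     (\<forall>x\<in>topspace X. X closure_of (range (\<lambda>n. zpow X T n x)) = topspace X)"

definition flow_hom ::
    "'a topology \<Rightarrow> ('a \<Rightarrow> 'a) \<Rightarrow> 'b topology \<Rightarrow> ('b \<Rightarrow> 'b) \<Rightarrow> ('a \<Rightarrow> 'b) \<Rightarrow> bool" where
  "flow_hom X T Y S \<phi> \<longleftrightarrow> continuous_map X Y \<phi> \<and>
     (\<forall>n. \<forall>x\<in>topspace X. \<phi> (zpow X T n x) = zpow Y S n (\<phi> x))"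

text \<open>
  Nets \<open>g\<^sub>i\<close> of integers are replaced, as usual in the library, by proper filters on
  the integers (the filter of sets in which the net eventually lies).
\<close>

definition proximal_pair :: "'a topology \<Rightarrow> ('a \<Rightarrow> 'a) \<Rightarrow> 'a \<Rightarrow> 'a \<Rightarrow> bool" where
  "proximal_pair X T x y \<longleftrightarrow> (\<exists>F z. F \<noteq> bot \<and>
     limitin X (\<lambda>n. zpow X T n x) z F \<and> limitin X (\<lambda>n. zpow X T n y) z F)"

definition fibre_relation :: "'a topology \<Rightarrow> ('a \<Rightarrow> 'b) \<Rightarrow> ('a \<times> 'a) set" where
  "fibre_relation X \<phi> = {(a, b). a \<in> topspace X \<and> b \<in> topspace X \<and> \<phi> a = \<phi> b}"

definition proximal_ext :: "'a topology \<Rightarrow> ('a \<Rightarrow> 'a) \<Rightarrow> ('a \<Rightarrow> 'b) \<Rightarrow> bool" where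
  "proximal_ext X T \<phi> \<longleftrightarrow> (\<forall>(a, b)\<in>fibre_relation X \<phi>. proximal_pair X T a b)"

definition diag_nbhd :: "'a topology \<Rightarrow> ('a \<times> 'a) set \<Rightarrow> bool" where
  "diag_nbhd X A \<longleftrightarrow> A \<subseteq> topspace X \<times> topspace X \<and>
     (\<exists>U. openin (prod_topology X X) U \<and> (\<forall>x\<in>topspace X. (x, x) \<in> U) \<and> U \<subseteq> A)"

definition equicontinuous_ext :: "'a topology \<Rightarrow> ('a \<Rightarrow> 'a) \<Rightarrow> ('a \<Rightarrow> 'b) \<Rightarrow> bool" where
  "equicontinuous_ext X T \<phi> \<longleftrightarrow>
     (\<forall>A. diag_nbhd X A \<longrightarrow>
       (\<exists>B. diag_nbhd X B \<and>
         (\<forall>n. \<forall>(a, b)\<in>B \<inter> fibre_relation X \<phi>. (zpow X T n a, zpow X T n b) \<in> A)))"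

text \<open>
  All flows of the tower live on the type \<open>'a\<close> that carries \<open>X\<close>. This is no restriction: each
  of them is a factor of \<open>X\<close>, so it has a copy on a subset of \<open>topspace X\<close>. For a tower of finite
  length there is no condition at limit ordinals.
\<close>

definition PI_of_order :: "nat \<Rightarrow> 'a topology \<Rightarrow> ('a \<Rightarrow> 'a) \<Rightarrow> bool" where
  "PI_of_order n X T \<longleftrightarrow>
     (\<exists>(W :: nat \<Rightarrow> 'a topology) (S :: nat \<Rightarrow> 'a \<Rightarrow> 'a) (\<phi> :: nat \<Rightarrow> 'a \<Rightarrow> 'a).
        (\<forall>i\<le>n. minimal_cascade (W i) (S i)) \<and>
        (\<exists>p. topspace (W 0) = {p}) \<and>
        (\<forall>i<n. flow_hom (W (Suc i)) (S (Suc i)) (W i) (S i) (\<phi> i) \<and>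
               \<not> homeomorphic_map (W (Suc i)) (W i) (\<phi> i) \<and>
               (proximal_ext (W (Suc i)) (S (Suc i)) (\<phi> i) \<or>
                equicontinuous_ext (W (Suc i)) (S (Suc i)) (\<phi> i))) \<and>
        W n = X \<and> S n = T)"

text \<open>
  Self-maps of \<open>topspace X\<close> are represented by functions that are \<open>undefined\<close> outside
  \<open>topspace X\<close> (the points of \<open>product_topology\<close>); correspondingly, composition is
  \<^const>\<open>compose\<close> on \<open>topspace X\<close>.
\<close>

definition enveloping_semigroup :: "'a topology \<Rightarrow> ('a \<Rightarrow> 'a) \<Rightarrow> ('a \<Rightarrow> 'a) set" where
  "enveloping_semigroup X T =
     product_topology (\<lambda>_. X) (topspace X) closure_of
       (range (\<lambda>n. restrict (zpow X T n) (topspace X)))"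

definition left_ideal :: "'a topology \<Rightarrow> ('a \<Rightarrow> 'a) \<Rightarrow> ('a \<Rightarrow> 'a) set \<Rightarrow> bool" where
  "left_ideal X T I \<longleftrightarrow> I \<noteq> {} \<and> I \<subseteq> enveloping_semigroup X T \<and>
     (\<forall>p\<in>enveloping_semigroup X T. \<forall>q\<in>I. compose (topspace X) p q \<in> I)"

definition minimal_left_ideal :: "'a topology \<Rightarrow> ('a \<Rightarrow> 'a) \<Rightarrow> ('a \<Rightarrow> 'a) set \<Rightarrow> bool" where
  "minimal_left_ideal X T I \<longleftrightarrow> left_ideal X T I \<and> \<not> (\<exists>J. left_ideal X T J \<and> J \<subset> I)"

text \<open>
  Every compact metrizable space has at most continuum many points, so it has a homeomorphic
  copy among the (arbitrary) topologies on sets of elements of \<^typ>\<open>nat \<Rightarrow> real\<close>. Asking for a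
  space of this type therefore loses nothing.
\<close>

type_synonym point = "nat \<Rightarrow> real"

end

theory Submission
  imports Defs
begin

text \<open>
  The flow is a subshift-like extension of the dyadic odometer \<open>Z\<close>. Give the position \<open>n\<close> over a
  point \<open>z\<close> a symbol that is read off from the two lowest binary digits \<open>i < m\<close> of \<open>z + n\<close>, namely
  the truth value of \<open>i \<in> set_decode m\<close>; the symbol is left free if \<open>z + n\<close> has at most one nonzero
  digit, that is, if \<open>z + n\<close> is \<open>0\<close> or a power of \<open>2\<close>. The pairs \<open>(z, y)\<close> obtained in this way form
  a flow \<open>Y\<close> under \<open>(z, y) \<mapsto> (z + 1, shift y)\<close>. The flow \<open>X\<close> consists of the pairs \<open>(z, x)\<close> for which
  the sequence of differences of \<open>x\<close> modulo \<open>2\<close> belongs to \<open>Y\<close>. Forgetting coordinates gives the tower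
  \<open>X \<rightarrow> Y \<rightarrow> Z \<rightarrow> point\<close>.

  The map \<open>X \<rightarrow> Y\<close> is two-to-one, with fibres \<open>{x, \<not> x}\<close>, and the odometer is equicontinuous
  (\<open>equicontinuous_YofX\<close>, \<open>equicontinuous_Z\<close>). Two points of \<open>Y\<close> over the same \<open>z\<close> differ at most where
  \<open>z + n\<close> is \<open>0\<close> or a power of \<open>2\<close>, hence nowhere far to the left; so they are negatively asymptotic and
  \<open>Y \<rightarrow> Z\<close> is proximal (\<open>proximal_ZofY\<close>).

  The digits \<open>m\<close> can be chosen so that \<open>set_decode m\<close> prescribes the symbols at all small powers of
  \<open>2\<close> at once. Therefore every finite window of a point of \<open>Y\<close> is forced by finitely many
  digits of a suitable integer (\<open>determined_approximation\<close>), which makes \<open>Y\<close> minimal. For \<open>X\<close> this gives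
  approximation up to the flip \<open>x \<mapsto> \<not> x\<close>; the free symbol at position \<open>0\<close> over \<open>z = 0\<close> yields a point whose
  orbit approximates a given window with both signs (\<open>both_signs\<close>), and \<open>X\<close> is minimal as well.

  Over \<open>z = 0\<close> the point \<open>x\<close> may be flipped independently on each gap \<open>2 ^ i < n \<le> 2 ^ (i + 1)\<close>. Given an
  independent family of subsets of the index set of the gaps, indexed by the sets \<open>A\<close> of natural numbers,
  flip a fixed \<open>x\<close> accordingly to get points \<open>a A\<close>. In the middle of a gap \<open>a A\<close> looks like \<open>x\<close> or like
  \<open>\<not> x\<close>, and all finite combinations of these alternatives occur. By compactness, for every set \<open>\<C>\<close>
  of sets of natural numbers there is an element \<open>p\<close> of the enveloping semigroup which maps \<open>a A\<close> to
  \<open>p (\<not> x)\<close> for \<open>A \<in> \<C>\<close> and to \<open>p x\<close> for \<open>A \<notin> \<C>\<close>. All such \<open>p\<close> form a closed left ideal. The ideals of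
  different \<open>\<C>\<close> are disjoint, because no \<open>p\<close> identifies \<open>x\<close> and \<open>\<not> x\<close>, and each of them contains a minimal left
  ideal (\<open>exists_minimal_left_ideal\<close>). Conversely a minimal left ideal is generated by any of its elements,
  and there are no more self-maps of \<open>X\<close> than sets of sets of natural numbers
  (\<open>minimal_left_ideals_lepoll\<close>).
\<close>

section \<open>Iterates of a cascade\<close>

lemma zpow_closed:
  assumes "cascade X T" "x \<in> topspace X"
  shows "zpow X T n x \<in> topspace X"
proof -
  have im: "T ` topspace X = topspace X"
    using assms(1) unfolding cascade_def by (simp add: homeomorphic_imp_surjective_map)
  have 1: "(T ^^ k) x \<in> topspace X" for k
    using im assms(2) by (induction k) auto
  have 2: "(inv_into (topspace X) T ^^ k) x \<in> topspace X" for k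
    using im assms(2) by (induction k) (auto intro: inv_into_into)
  show ?thesis using 1 2 by (simp add: zpow_def)
qed

lemma zpow_succ:
  assumes "cascade X T" "x \<in> topspace X"
  shows "zpow X T (n + 1) x = T (zpow X T n x)"
proof (cases "0 \<le> n")
  case True
  then show ?thesis by (simp add: zpow_def nat_add_distrib)
next
  case False
  define m where "m = nat (- n - 1)"
  have im: "T ` topspace X = topspace X"
    using assms(1) unfolding cascade_def by (simp add: homeomorphic_imp_surjective_map)
  have n: "n = - int (Suc m)" using False by (simp add: m_def)
  have s: "zpow X T n x = inv_into (topspace X) T (zpow X T (n + 1) x)"
    unfolding n by (cases m) (simp_all add: zpow_def nat_add_distrib)
  show ?thesis
    unfolding s using im zpow_closed[OF assms, of "n + 1"] by (metis f_inv_into_f)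
qed

lemma zpow_zero [simp]: "zpow X T 0 x = x"
  by (simp add: zpow_def)

lemma cascade_inj:
  assumes "cascade X T"
  shows "inj_on T (topspace X)"
  using assms unfolding cascade_def homeomorphic_map_def by blast

text \<open>
  Identifies the iterates with an explicitly given action; negative exponents are reached because
  \<open>T\<close> is injective.
\<close>

lemma zpow_eqI:
  assumes X: "cascade X T"
    and zero: "\<And>x. x \<in> topspace X \<Longrightarrow> act 0 x = x"
    and closed: "\<And>n x. x \<in> topspace X \<Longrightarrow> act n x \<in> topspace X"
    and step: "\<And>n x. x \<in> topspace X \<Longrightarrow> T (act n x) = act (n + 1) x"
    and x: "x \<in> topspace X"
  shows "zpow X T n x = act (n :: int) x"
proof (induction n rule: int_induct[where k = 0])
  case base
  then show ?case using zero x by simp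
next
  case (step1 i)
  then show ?case using zpow_succ[OF X x, of i] step[OF x, of i] by simp
next
  case (step2 i)
  have "T (zpow X T (i - 1) x) = T (act (i - 1) x)"
    using zpow_succ[OF X x, of "i - 1"] step[OF x, of "i - 1"] step2 by simp
  then show ?case
    using cascade_inj[OF X] closed[OF x] zpow_closed[OF X x] by (meson inj_onD)
qed

lemma zpow_add:
  assumes X: "cascade X T" and x: "x \<in> topspace X"
  shows "zpow X T n (zpow X T m x) = zpow X T (n + m) x"
proof (induction n rule: int_induct[where k = 0])
  case base
  then show ?case by simp
next
  case (step1 i)
  then show ?case
    using zpow_succ[OF X zpow_closed[OF X x], of i m] zpow_succ[OF X x, of "i + m"]
    by (simp add: algebra_simps)
next
  case (step2 i)
  have "T (zpow X T (i - 1) (zpow X T m x)) = T (zpow X T (i - 1 + m) x)"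
    using zpow_succ[OF X zpow_closed[OF X x], of "i - 1" m] zpow_succ[OF X x, of "i - 1 + m"] step2
    by (simp add: algebra_simps)
  then show ?case
    using cascade_inj[OF X] zpow_closed[OF X] x by (meson inj_onD)
qed

lemma continuous_map_funpow: "continuous_map X X f \<Longrightarrow> continuous_map X X (f ^^ k)"
proof (induction k)
  case (Suc k)
  then show ?case using continuous_map_compose[of X X "f ^^ k" X f] by (simp add: o_def)
qed simp

lemma continuous_map_zpow:
  assumes "cascade X T"
  shows "continuous_map X X (zpow X T n)"
proof -
  have T: "homeomorphic_map X X T" using assms by (simp add: cascade_def)
  then obtain g where g: "homeomorphic_maps X X T g" by (auto simp: homeomorphic_map_maps)
  have "continuous_map X X (inv_into (topspace X) T)"
  proof (rule continuous_map_eq)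
    show "continuous_map X X g" using g by (simp add: homeomorphic_maps_def)
    fix x assume x: "x \<in> topspace X"
    then have "g x \<in> topspace X" "T (g x) = x"
      using g by (auto simp: homeomorphic_maps_def continuous_map_def)
    then show "g x = inv_into (topspace X) T x"
      using cascade_inj[OF assms] by (metis inv_into_f_f)
  qed
  moreover have "continuous_map X X T"
    using T by (simp add: homeomorphic_imp_continuous_map)
  ultimately show ?thesis
    unfolding zpow_def by (auto intro: continuous_map_funpow)
qed

section \<open>Left ideals of the enveloping semigroup\<close>

abbreviation selfmaps :: "'a topology \<Rightarrow> ('a \<Rightarrow> 'a) topology" where
  "selfmaps X \<equiv> product_topology (\<lambda>_. X) (topspace X)"

lemma selfmaps_compact_Hausdorff:
  assumes "cascade X T"
  shows "compact_space (selfmaps X)" "Hausdorff_space (selfmaps X)"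
  using assms by (auto simp: cascade_def compact_space_product_topology Hausdorff_space_product_topology)

lemma closedin_enveloping_semigroup: "closedin (selfmaps X) (enveloping_semigroup X T)"
  by (simp add: enveloping_semigroup_def)

lemma restrict_zpow_in_selfmaps:
  assumes "cascade X T"
  shows "restrict (zpow X T n) (topspace X) \<in> topspace (selfmaps X)"
  using zpow_closed[OF assms] by (auto simp: topspace_product_topology)

lemma restrict_zpow_in_enveloping_semigroup:
  assumes "cascade X T"
  shows "restrict (zpow X T n) (topspace X) \<in> enveloping_semigroup X T"
proof -
  have "range (\<lambda>n. restrict (zpow X T n) (topspace X)) \<subseteq> topspace (selfmaps X)"
    using restrict_zpow_in_selfmaps[OF assms] by blast
  then show ?thesis
    using closure_of_subset unfolding enveloping_semigroup_def by blast
qed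

text \<open>
  A closed condition that holds for all iterates holds on the whole enveloping semigroup. All
  properties of its elements below are obtained in this way.
\<close>

lemma enveloping_semigroup_induct:
  assumes p: "p \<in> enveloping_semigroup X T"
    and C: "closedin (selfmaps X) {f \<in> topspace (selfmaps X). P f}"
    and X: "cascade X T"
    and gen: "\<And>n. P (restrict (zpow X T n) (topspace X))"
  shows "P p"
proof -
  have "enveloping_semigroup X T \<subseteq> {f \<in> topspace (selfmaps X). P f}"
    unfolding enveloping_semigroup_def
    by (rule closure_of_minimal[OF _ C]) (use gen restrict_zpow_in_selfmaps[OF X] in blast)
  then show ?thesis using p by blast
qed

lemma continuous_map_eval:
  "x \<in> topspace X \<Longrightarrow> continuous_map (selfmaps X) X (\<lambda>f. f x)"
  by (rule continuous_map_product_projection)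

lemma selfmaps_apply: "f \<in> topspace (selfmaps X) \<Longrightarrow> x \<in> topspace X \<Longrightarrow> f x \<in> topspace X"
  by (auto simp: topspace_product_topology)

lemma continuous_map_compose_left:
  assumes "continuous_map X X g"
  shows "continuous_map (selfmaps X) (selfmaps X) (\<lambda>f. compose (topspace X) g f)"
  unfolding continuous_map_componentwise
proof (intro conjI ballI)
  fix x assume x: "x \<in> topspace X"
  have "continuous_map (selfmaps X) X (g \<circ> (\<lambda>f. f x))"
    by (rule continuous_map_compose[OF continuous_map_eval[OF x] assms])
  then show "continuous_map (selfmaps X) X (\<lambda>f. compose (topspace X) g f x)"
    using x by (simp add: compose_def o_def)
qed (auto simp: compose_def)

lemma continuous_map_compose_right:
  assumes "p \<in> topspace (selfmaps X)"
  shows "continuous_map (selfmaps X) (selfmaps X) (\<lambda>f. compose (topspace X) f p)"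
  unfolding continuous_map_componentwise
proof (intro conjI ballI)
  fix x assume x: "x \<in> topspace X"
  show "continuous_map (selfmaps X) X (\<lambda>f. compose (topspace X) f p x)"
    using continuous_map_eval[OF selfmaps_apply[OF assms x]] x by (simp add: compose_def)
qed (auto simp: compose_def)

lemma enveloping_semigroup_subset: "enveloping_semigroup X T \<subseteq> topspace (selfmaps X)"
  using closedin_subset[OF closedin_enveloping_semigroup] .

text \<open>
  Composition is continuous in the left factor for every fixed right factor, but in the right factor only
  if the left factor is continuous. So the left factor is first taken to be an iterate, and the right one is
  varied; then the left one is varied.
\<close>

lemma enveloping_semigroup_compose:
  assumes X: "cascade X T"
    and q: "q \<in> enveloping_semigroup X T" and p: "p \<in> enveloping_semigroup X T"
  shows "compose (topspace X) q p \<in> enveloping_semigroup X T"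
proof -
  let ?E = "enveloping_semigroup X T"
  let ?g = "\<lambda>n. restrict (zpow X T n) (topspace X)"
  have left: "compose (topspace X) (?g n) r \<in> ?E" if r: "r \<in> ?E" for n r
  proof (rule enveloping_semigroup_induct[OF r _ X])
    have "continuous_map X X (?g n)"
      using continuous_map_zpow[OF X] by (rule continuous_map_eq) simp
    from closedin_continuous_map_preimage[OF continuous_map_compose_left[OF this]
        closedin_enveloping_semigroup]
    show "closedin (selfmaps X)
        {f \<in> topspace (selfmaps X). compose (topspace X) (?g n) f \<in> ?E}" .
    fix m
    have "compose (topspace X) (?g n) (?g m) = ?g (n + m)"
      using zpow_add[OF X] zpow_closed[OF X] by (auto simp: compose_def fun_eq_iff)
    then show "compose (topspace X) (?g n) (?g m) \<in> ?E"
      using restrict_zpow_in_enveloping_semigroup[OF X] by simp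
  qed
  show ?thesis
  proof (rule enveloping_semigroup_induct[OF q _ X])
    show "closedin (selfmaps X) {f \<in> topspace (selfmaps X). compose (topspace X) f p \<in> ?E}"
      using closedin_continuous_map_preimage[OF continuous_map_compose_right
          closedin_enveloping_semigroup] p enveloping_semigroup_subset by blast
  qed (use left p in blast)
qed

text \<open>
  The ideal is the image of a compact set under composition with \<open>p\<close> on the right, which is
  continuous; hence it is closed.
\<close>

lemma principal_left_ideal:
  assumes X: "cascade X T" and p: "p \<in> enveloping_semigroup X T"
  defines "I \<equiv> (\<lambda>q. compose (topspace X) q p) ` enveloping_semigroup X T"
  shows "left_ideal X T I" "closedin (selfmaps X) I"
proof -
  let ?E = "enveloping_semigroup X T"
  have p': "p \<in> topspace (selfmaps X)"
    using p enveloping_semigroup_subset by blast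
  have sub: "I \<subseteq> ?E" and ne: "I \<noteq> {}"
    unfolding I_def using enveloping_semigroup_compose[OF X _ p] p by auto
  have "compose (topspace X) r q' \<in> I" if r: "r \<in> ?E" and q': "q' \<in> I" for r q'
  proof -
    obtain q where q: "q \<in> ?E" "q' = compose (topspace X) q p" using q' by (auto simp: I_def)
    have "p \<in> topspace X \<rightarrow> topspace X" using selfmaps_apply[OF p'] by blast
    then have "compose (topspace X) r q' = compose (topspace X) (compose (topspace X) r q) p"
      unfolding q(2) by (rule compose_assoc)
    then show ?thesis
      unfolding I_def using enveloping_semigroup_compose[OF X r q(1)] by blast
  qed
  then show "left_ideal X T I"
    unfolding left_ideal_def using sub ne by blast
  have "compactin (selfmaps X) ?E"
    by (simp add: closedin_compact_space closedin_enveloping_semigroup selfmaps_compact_Hausdorff[OF X])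
  then have "compactin (selfmaps X) I"
    unfolding I_def by (rule image_compactin[OF _ continuous_map_compose_right[OF p']])
  then show "closedin (selfmaps X) I"
    by (simp add: compactin_imp_closedin selfmaps_compact_Hausdorff[OF X])
qed

lemma minimal_left_ideal_principal:
  assumes X: "cascade X T" and I: "minimal_left_ideal X T I" and p: "p \<in> I"
  shows "I = (\<lambda>q. compose (topspace X) q p) ` enveloping_semigroup X T"
proof -
  have "p \<in> enveloping_semigroup X T"
    using I p by (auto simp: minimal_left_ideal_def left_ideal_def)
  then have "left_ideal X T ((\<lambda>q. compose (topspace X) q p) ` enveloping_semigroup X T)"
    by (rule principal_left_ideal(1)[OF X])
  moreover have "(\<lambda>q. compose (topspace X) q p) ` enveloping_semigroup X T \<subseteq> I"
    using I p by (auto simp: minimal_left_ideal_def left_ideal_def)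
  ultimately show ?thesis using I unfolding minimal_left_ideal_def by blast
qed

text \<open>
  Zorn's lemma applies to the closed left ideals, since a chain of them has nonempty intersection by
  compactness. An ideal that is minimal among the closed ones is minimal among all: a smaller ideal would
  contain a principal ideal, which is closed.
\<close>

lemma exists_minimal_left_ideal:
  assumes X: "cascade X T" and L: "left_ideal X T L" "closedin (selfmaps X) L"
  obtains I where "minimal_left_ideal X T I" "I \<subseteq> L"
proof -
  let ?A = "{J. left_ideal X T J \<and> closedin (selfmaps X) J \<and> J \<subseteq> L}"
  let ?r = "relation_of (\<lambda>J K. K \<subseteq> J) ?A"
  have "\<exists>M\<in>?A. \<forall>J\<in>?A. J \<subseteq> M \<longrightarrow> J = M"
  proof (rule predicate_Zorn)
    show "partial_order_on ?A ?r"
      by (rule partial_order_on_relation_ofI) auto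
    fix C assume "C \<in> Chains ?r"
    then have chain: "\<And>J K. J \<in> C \<Longrightarrow> K \<in> C \<Longrightarrow> J \<subseteq> K \<or> K \<subseteq> J" and C: "C \<subseteq> ?A"
      by (auto simp: Chains_def relation_of_def)
    show "\<exists>U\<in>?A. \<forall>J\<in>C. U \<subseteq> J"
    proof (cases "C = {}")
      case True
      then show ?thesis using L by blast
    next
      case False
      have least: "\<F> \<noteq> {} \<Longrightarrow> \<Inter>\<F> \<in> \<F>" if "finite \<F>" "\<F> \<subseteq> C" for \<F>
        using that
      proof (induction \<F> rule: finite_induct)
        case (insert J \<F>)
        show ?case
        proof (cases "\<F> = {}")
          case False
          then have "\<Inter>\<F> \<in> \<F>" using insert by auto
          then have "J \<subseteq> \<Inter>\<F> \<or> \<Inter>\<F> \<subseteq> J" using chain insert.prems by auto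
          then have "\<Inter>(insert J \<F>) = J \<or> \<Inter>(insert J \<F>) = \<Inter>\<F>" by auto
          then show ?thesis using \<open>\<Inter>\<F> \<in> \<F>\<close> by auto
        qed simp
      qed simp
      have "\<Inter>\<F> \<noteq> {}" if "finite \<F>" "\<F> \<subseteq> C" for \<F>
        using least[OF that] that C by (cases "\<F> = {}") (auto simp: left_ideal_def)
      moreover have "\<forall>J\<in>C. closedin (selfmaps X) J" using C by blast
      ultimately have "\<Inter>C \<noteq> {}"
        using selfmaps_compact_Hausdorff(1)[OF X, unfolded compact_space_fip, rule_format, of C]
        by simp
      moreover have "closedin (selfmaps X) (\<Inter>C)"
        using False C by (intro closedin_Inter) auto
      moreover obtain J where J: "J \<in> C" using False by blast
      then have "\<Inter>C \<subseteq> J" "J \<subseteq> L" "J \<subseteq> enveloping_semigroup X T"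
        using C by (auto simp: left_ideal_def)
      moreover have "compose (topspace X) r q \<in> K"
        if "r \<in> enveloping_semigroup X T" "q \<in> \<Inter>C" "K \<in> C" for r q K
        using that C by (auto simp: left_ideal_def)
      ultimately have "left_ideal X T (\<Inter>C)" "\<Inter>C \<subseteq> L"
        unfolding left_ideal_def by blast+
      then have "\<Inter>C \<in> ?A"
        using \<open>closedin (selfmaps X) (\<Inter>C)\<close> by blast
      then show ?thesis by blast
    qed
  qed
  then obtain I where I: "I \<in> ?A" and min: "\<And>J. J \<in> ?A \<Longrightarrow> J \<subseteq> I \<Longrightarrow> J = I" by blast
  have "minimal_left_ideal X T I"
    unfolding minimal_left_ideal_def
  proof (intro conjI notI)
    show "left_ideal X T I" using I by blast
    assume "\<exists>J. left_ideal X T J \<and> J \<subset> I"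
    then obtain J where J: "left_ideal X T J" "J \<subset> I" by blast
    then obtain p where p: "p \<in> J" "p \<in> enveloping_semigroup X T" by (auto simp: left_ideal_def)
    let ?P = "(\<lambda>q. compose (topspace X) q p) ` enveloping_semigroup X T"
    have "?P \<subseteq> J" using J p by (auto simp: left_ideal_def)
    moreover from this have "?P = I"
      using principal_left_ideal[OF X p(2)] I J by (intro min) auto
    ultimately show False using J by blast
  qed
  then show thesis using that I by blast
qed

section \<open>Coding of odometer points and two-sided sequences\<close>

text \<open>
  Even coordinates hold the residues of an odometer point modulo the powers of \<open>2\<close>, odd coordinates hold a
  two-sided binary sequence.
\<close>

definition enc :: "(nat \<Rightarrow> int) \<Rightarrow> (int \<Rightarrow> bool) \<Rightarrow> point" where
  "enc z u j = (if even j then of_int (z (j div 2)) else of_bool (u (int_decode (j div 2))))"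

definition base :: "point \<Rightarrow> nat \<Rightarrow> int" where
  "base p k = \<lfloor>p (2 * k)\<rfloor>"

definition symbols :: "point \<Rightarrow> int \<Rightarrow> bool" where
  "symbols p n \<longleftrightarrow> p (Suc (2 * int_encode n)) = 1"

lemma base_enc [simp]: "base (enc z u) = z"
  by (simp add: base_def enc_def fun_eq_iff)

lemma symbols_enc [simp]: "symbols (enc z u) = u"
  by (simp add: symbols_def enc_def fun_eq_iff)

lemma enc_eq_iff [simp]: "enc z u = enc z' u' \<longleftrightarrow> z = z' \<and> u = u'"
  by (metis base_enc symbols_enc)

text \<open>
  The basic entourages: all coordinates are integers, so two points are near each other exactly if they agree
  on a large window.
\<close>

definition close :: "nat \<Rightarrow> point \<Rightarrow> point \<Rightarrow> bool" where
  "close N p q \<longleftrightarrow> (\<forall>k\<le>N. base p k = base q k) \<and> (\<forall>n. \<bar>n\<bar> \<le> int N \<longrightarrow> symbols p n = symbols q n)"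

lemma close_mono: "close N p q \<Longrightarrow> M \<le> N \<Longrightarrow> close M p q"
  unfolding close_def by (meson le_trans of_nat_mono order_trans)

lemma close_sym: "close N p q \<Longrightarrow> close N q p"
  by (simp add: close_def)

lemma tendsto_coordinatewise:
  fixes f :: "'a \<Rightarrow> point"
  shows "(f \<longlongrightarrow> l) F \<longleftrightarrow> (\<forall>j. ((\<lambda>i. f i j) \<longlongrightarrow> l j) F)"
proof -
  have "(f \<longlongrightarrow> l) F \<longleftrightarrow> limitin (product_topology (\<lambda>_. euclidean) UNIV) f l F"
    by (simp add: euclidean_product_topology)
  also have "\<dots> \<longleftrightarrow> (\<forall>j. ((\<lambda>i. f i j) \<longlongrightarrow> l j) F)"
    by (simp add: limitin_componentwise)
  finally show ?thesis .
qed

lemma tendsto_Ints_imp_eventually_eq: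
  fixes f :: "'a \<Rightarrow> real"
  assumes lim: "(f \<longlongrightarrow> l) F" and int: "\<And>i. f i \<in> \<int>" and l: "l \<in> \<int>"
  shows "eventually (\<lambda>i. f i = l) F"
proof -
  have "eventually (\<lambda>i. dist (f i) l < 1) F"
    using lim by (simp add: tendsto_iff)
  then show ?thesis
  proof (rule eventually_mono)
    fix i assume d: "dist (f i) l < 1"
    obtain a b where "f i = of_int a" "l = of_int b" using int[of i] l by (auto elim!: Ints_cases)
    with d show "f i = l" by (simp add: dist_real_def abs_less_iff)
  qed
qed

text \<open>
  The image of \<^const>\<open>enc\<close>, described by the decoding functions.
\<close>

definition codes :: "point set" where
  "codes = {p. p = enc (base p) (symbols p)}"

lemma enc_in_codes [simp]: "enc z u \<in> codes"
  by (simp add: codes_def)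

lemma enc_Ints: "enc z u j \<in> \<int>"
  by (simp add: enc_def)

lemma enc_coordinate_cases:
  obtains k where "\<And>z u. enc z u j = of_int (z k)"
  | n where "\<And>z u. enc z u j = of_bool (u n)"
  by (cases "even j") (auto simp: enc_def)

lemma codes_decode: "p \<in> codes \<Longrightarrow> p = enc (base p) (symbols p)"
  by (simp add: codes_def)

lemma codes_Ints:
  assumes "p \<in> codes"
  shows "p j \<in> \<int>"
  by (subst codes_decode[OF assms]) (rule enc_Ints)

lemma tendsto_enc_iff:
  assumes p: "\<And>i. p i \<in> codes" and q: "q \<in> codes"
  shows "(p \<longlongrightarrow> q) F \<longleftrightarrow> (\<forall>N. eventually (\<lambda>i. close N (p i) q) F)"
proof
  have pe: "p i = enc (base (p i)) (symbols (p i))" for i by (rule codes_decode[OF p])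
  have qe: "q = enc (base q) (symbols q)" by (rule codes_decode[OF q])
  have pi: "p i j \<in> \<int>" for i j by (rule codes_Ints[OF p])
  have qi: "q j \<in> \<int>" for j by (rule codes_Ints[OF q])
  {
    assume "(p \<longlongrightarrow> q) F"
    then have ev: "eventually (\<lambda>i. p i j = q j) F" for j
      using tendsto_Ints_imp_eventually_eq[of "\<lambda>i. p i j" "q j" F] pi qi
      unfolding tendsto_coordinatewise by blast
    have "eventually (\<lambda>i. base (p i) k = base q k) F" for k
      using ev[of "2 * k"] by (rule eventually_mono) (simp add: base_def)
    then have 1: "eventually (\<lambda>i. \<forall>k\<in>{..N}. base (p i) k = base q k) F" for N
      by (intro eventually_ball_finite) auto
    have "eventually (\<lambda>i. symbols (p i) n = symbols q n) F" for n
      using ev[of "Suc (2 * int_encode n)"] by (rule eventually_mono) (simp add: symbols_def)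
    then have 2: "eventually (\<lambda>i. \<forall>n\<in>{- int N..int N}. symbols (p i) n = symbols q n) F" for N
      by (intro eventually_ball_finite) auto
    show "\<forall>N. eventually (\<lambda>i. close N (p i) q) F"
    proof
      fix N show "eventually (\<lambda>i. close N (p i) q) F"
        using 1[of N] 2[of N] by eventually_elim (simp add: close_def abs_le_iff)
    qed
  next
    assume cl: "\<forall>N. eventually (\<lambda>i. close N (p i) q) F"
    have "eventually (\<lambda>i. p i j = q j) F" for j
    proof (rule enc_coordinate_cases[of j])
      fix k assume k: "\<And>z u. enc z u j = of_int (z k)"
      show ?thesis using cl[rule_format, of k]
      proof (rule eventually_mono)
        fix i assume "close k (p i) q"
        then show "p i j = q j"
          using k[of "base (p i)" "symbols (p i)"] k[of "base q" "symbols q"] pe[of i] qe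
            by (simp add: close_def)
      qed
    next
      fix n assume n: "\<And>z u. enc z u j = of_bool (u n)"
      show ?thesis using cl[rule_format, of "nat \<bar>n\<bar>"]
      proof (rule eventually_mono)
        fix i assume "close (nat \<bar>n\<bar>) (p i) q"
        then show "p i j = q j"
          using n[of "base (p i)" "symbols (p i)"] n[of "base q" "symbols q"] pe[of i] qe
            by (simp add: close_def)
      qed
    qed
    then show "(p \<longlongrightarrow> q) F"
      unfolding tendsto_coordinatewise by (intro allI tendsto_eventually)
  }
qed

lemma enc_limit:
  assumes p: "\<And>i. p i \<in> codes" and lim: "p \<longlonglongrightarrow> q"
  shows "q \<in> codes"
proof -
  have pe: "p i = enc (base (p i)) (symbols (p i))" for i by (rule codes_decode[OF p])
  have pi: "p i j \<in> \<int>" for i j by (rule codes_Ints[OF p])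
  have lj: "(\<lambda>i. p i j) \<longlonglongrightarrow> q j" for j using lim tendsto_coordinatewise by blast
  have qi: "q j \<in> \<int>" for j
    by (rule Lim_in_closed_set[OF closed_Ints _ _ lj]) (auto simp: pi)
  have ex: "\<exists>i. p i j = q j" for j
    using tendsto_Ints_imp_eventually_eq[OF lj pi qi] eventually_happens' sequentially_bot by blast
  have "q j = enc (base q) (symbols q) j" for j
  proof (cases "even j")
    case True
    then obtain k where k: "j = 2 * k" by (auto elim: evenE)
    show ?thesis using qi[of j] by (auto simp: k enc_def base_def elim!: Ints_cases)
  next
    case False
    then obtain k where k: "j = Suc (2 * k)" by (auto elim: oddE)
    obtain i where "p i j = q j" using ex by blast
    moreover have "p i j = of_bool (symbols (p i) (int_decode (j div 2)))"
      by (subst pe) (simp add: enc_def False)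
    ultimately have "q j = 0 \<or> q j = 1" by (metis of_bool_eq(1,2))
    then show ?thesis by (auto simp: k enc_def symbols_def)
  qed
  then have "q = enc (base q) (symbols q)" by (rule ext)
  then show ?thesis by (subst \<open>q = enc (base q) (symbols q)\<close>) (rule enc_in_codes)
qed

section \<open>Coded spaces\<close>

text \<open>
  The dyadic integers as the inverse limit of the rings of residues modulo \<open>2 ^ k\<close>.
\<close>

definition odometer :: "(nat \<Rightarrow> int) set" where
  "odometer = {z. \<forall>k. z (Suc k) mod 2 ^ k = z k}"

definition coded :: "((nat \<Rightarrow> int) \<Rightarrow> (int \<Rightarrow> bool) \<Rightarrow> bool) \<Rightarrow> point set" where
  "coded R = {enc z u | z u. z \<in> odometer \<and> R z u}"

lemma enc_in_coded_iff [simp]: "enc z u \<in> coded R \<longleftrightarrow> z \<in> odometer \<and> R z u"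
  by (auto simp: coded_def)

lemma codedE:
  assumes "p \<in> coded R"
  obtains z u where "p = enc z u" "z \<in> odometer" "R z u"
  using assms by (auto simp: coded_def)

lemma coded_codes: "p \<in> coded R \<Longrightarrow> p \<in> codes"
  by (elim codedE) simp

lemma odometer_step: "z \<in> odometer \<Longrightarrow> z (Suc k) mod 2 ^ k = z k"
  by (simp add: odometer_def)

lemma odometer_bounds:
  assumes "z \<in> odometer"
  shows "0 \<le> z k" "z k < 2 ^ k"
proof -
  have "z k = z (Suc k) mod 2 ^ k" using odometer_step[OF assms] by simp
  then show "0 \<le> z k" "z k < 2 ^ k" by simp_all
qed

text \<open>
  In a convergent sequence of coded points every coordinate is eventually constant, so the limit is coded
  and agrees on every window with a term of the sequence. The hypothesis is easily checked below, because the
  relations are conjunctions of conditions on finitely many coordinates.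
\<close>

lemma closed_coded:
  assumes R: "\<And>z u. z \<in> odometer \<Longrightarrow>
      (\<And>N. \<exists>z' u'. z' \<in> odometer \<and> R z' u' \<and> close N (enc z' u') (enc z u)) \<Longrightarrow> R z u"
  shows "closed (coded R)"
  unfolding closed_sequential_limits
proof (intro allI impI, elim conjE)
  fix p q assume p: "\<forall>n. p n \<in> coded R" and lim: "p \<longlonglongrightarrow> q"
  have pr: "p n \<in> codes" for n using p by (blast intro: coded_codes)
  from enc_limit[OF pr lim] have qr: "q \<in> codes" .
  then obtain z u where q: "q = enc z u" using codes_decode by blast
  have app: "\<exists>z' u'. z' \<in> odometer \<and> R z' u' \<and> close N (enc z' u') (enc z u)" for N
  proof -
    have "eventually (\<lambda>i. close N (p i) q) sequentially"
      using lim tendsto_enc_iff[of p q, OF pr qr] by blast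
    then obtain i where "close N (p i) q" using eventually_happens' sequentially_bot by blast
    moreover obtain z' u' where "p i = enc z' u'" "z' \<in> odometer" "R z' u'"
      using p by (blast elim: codedE)
    ultimately show ?thesis unfolding q by auto
  qed
  have "z (Suc k) mod 2 ^ k = z k" for k
  proof -
    obtain z' u' where "z' \<in> odometer" "close (Suc k) (enc z' u') (enc z u)" using app by blast
    moreover from this(2) have "z' k = z k" "z' (Suc k) = z (Suc k)" by (simp_all add: close_def)
    ultimately show ?thesis using odometer_step[of z' k] by simp
  qed
  then have z: "z \<in> odometer" by (simp add: odometer_def)
  then show "q \<in> coded R" using R[OF z app] by (simp add: q)
qed

lemma compact_coded:
  assumes "closed (coded R)"
  shows "compact (coded R)"
proof -
  let ?B = "PiE UNIV (\<lambda>j::nat. {0..2 ^ j :: real})"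
  have "compactin (product_topology (\<lambda>_::nat. euclideanreal) UNIV) ?B"
    by (simp add: compactin_PiE)
  then have "compact ?B" by (simp add: euclidean_product_topology)
  moreover have "coded R \<subseteq> ?B"
  proof
    fix p assume "p \<in> coded R"
    then obtain z u where p: "p = enc z u" "z \<in> odometer" by (auto elim: codedE)
    have "p j \<in> {0..2 ^ j}" for j
    proof (cases "even j")
      case True
      have "real_of_int (z (j div 2)) \<le> 2 ^ (j div 2)"
        using odometer_bounds(2)[OF p(2), of "j div 2"]
        by (metis less_imp_le of_int_le_iff of_int_numeral of_int_power)
      also have "\<dots> \<le> 2 ^ j" by (intro power_increasing) auto
      finally show ?thesis using odometer_bounds(1)[OF p(2)] True by (simp add: p(1) enc_def)
    qed (simp add: p(1) enc_def)
    then show "p \<in> ?B" by auto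
  qed
  ultimately have "compact (?B \<inter> coded R)" by (simp add: compact_Int_closed assms)
  then show ?thesis using \<open>coded R \<subseteq> ?B\<close> by (simp add: inf.absorb2)
qed

lemma continuous_on_coded:
  assumes f: "\<And>p. p \<in> coded R \<Longrightarrow> f p \<in> codes"
    and loc: "\<And>N. \<exists>M. \<forall>p\<in>coded R. \<forall>q\<in>coded R. close M p q \<longrightarrow> close N (f p) (f q)"
  shows "continuous_on (coded R) f"
proof (rule continuous_on_sequentiallyI)
  fix p q assume p: "\<forall>n. p n \<in> coded R" and q: "q \<in> coded R" and lim: "p \<longlonglongrightarrow> q"
  have cl: "\<forall>N. eventually (\<lambda>i. close N (p i) q) sequentially"
    by (rule tendsto_enc_iff[THEN iffD1, OF _ _ lim]) (use p q in \<open>blast intro: coded_codes\<close>)+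
  show "(\<lambda>n. f (p n)) \<longlonglongrightarrow> f q"
  proof (rule tendsto_enc_iff[THEN iffD2])
    show "\<forall>N. eventually (\<lambda>i. close N (f (p i)) (f q)) sequentially"
    proof
      fix N
      obtain M where M: "\<forall>p\<in>coded R. \<forall>q\<in>coded R. close M p q \<longrightarrow> close N (f p) (f q)"
        using loc by blast
      show "eventually (\<lambda>i. close N (f (p i)) (f q)) sequentially"
        using cl[rule_format, of M] by (rule eventually_mono) (use M p q in blast)
    qed
  qed (use p q f in blast)+
qed

lemma metrizable_top_of_set: "metrizable_space (top_of_set S)" for S :: "'a::metric_space set"
  by (intro metrizable_space_subtopology metrizable_space_euclidean)

section \<open>The shift flow on a coded space\<close>

definition add_int :: "int \<Rightarrow> (nat \<Rightarrow> int) \<Rightarrow> nat \<Rightarrow> int" where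
  "add_int n z k = (z k + n) mod 2 ^ k"

definition act :: "int \<Rightarrow> point \<Rightarrow> point" where
  "act n p = enc (add_int n (base p)) (\<lambda>m. symbols p (m + n))"

lemma mod_mod_power_le: "k \<le> m \<Longrightarrow> (a mod 2 ^ m) mod 2 ^ k = (a :: int) mod 2 ^ k"
  by (simp add: le_imp_power_dvd mod_mod_cancel)

lemma odometer_mod:
  assumes z: "z \<in> odometer" and "k \<le> m"
  shows "z m mod 2 ^ k = z k"
  using assms(2)
proof (induction m rule: dec_induct)
  case base
  show ?case using odometer_bounds[OF z, of k] by (rule mod_pos_pos_trivial)
next
  case (step m)
  have "z (Suc m) mod 2 ^ m = z m" by (rule odometer_step[OF z])
  then show ?case using step mod_mod_power_le[of k m "z (Suc m)"] by simp
qed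

lemma add_int_odometer:
  assumes "z \<in> odometer"
  shows "add_int n z \<in> odometer"
proof -
  have "add_int n z (Suc k) mod 2 ^ k = add_int n z k" for k
  proof -
    have "z k = z (Suc k) mod 2 ^ k" using odometer_step[OF assms] by simp
    then have "add_int n z k = (z (Suc k) + n) mod 2 ^ k"
      by (simp add: add_int_def mod_add_left_eq)
    then show ?thesis
      using mod_mod_power_le[of k "Suc k" "z (Suc k) + n"] by (simp add: add_int_def)
  qed
  then show ?thesis by (simp add: odometer_def)
qed

lemma add_int_0 [simp]: "z \<in> odometer \<Longrightarrow> add_int 0 z = z"
  by (simp add: add_int_def odometer_bounds fun_eq_iff)

lemma add_int_add [simp]: "add_int n (add_int m z) = add_int (m + n) z"
  by (simp add: add_int_def fun_eq_iff mod_add_left_eq add.assoc)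

lemma act_enc [simp]: "act n (enc z u) = enc (add_int n z) (\<lambda>m. u (m + n))"
  by (simp add: act_def)

lemma act_add: "act n (act m p) = act (m + n) p"
  by (simp add: act_def ac_simps)

definition invariant :: "((nat \<Rightarrow> int) \<Rightarrow> (int \<Rightarrow> bool) \<Rightarrow> bool) \<Rightarrow> bool" where
  "invariant R \<longleftrightarrow> (\<forall>z u n. R z u \<longrightarrow> R (add_int n z) (\<lambda>m. u (m + n)))"

lemma act_coded:
  assumes "invariant R" "p \<in> coded R"
  shows "act n p \<in> coded R"
proof -
  obtain z u where p: "p = enc z u" "z \<in> odometer" "R z u" using assms(2) by (rule codedE)
  have "R (add_int n z) (\<lambda>m. u (m + n))" using assms(1) p(3) unfolding invariant_def by blast
  then show ?thesis by (simp add: p add_int_odometer)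
qed

lemma act_0: "p \<in> coded R \<Longrightarrow> act 0 p = p"
  by (auto elim!: codedE)

lemma act_close:
  assumes "close (N + nat \<bar>n\<bar>) p q"
  shows "close N (act n p) (act n q)"
  unfolding close_def
proof (intro conjI allI impI)
  fix k assume "k \<le> N"
  then show "base (act n p) k = base (act n q) k"
    using assms by (simp add: close_def act_def add_int_def)
next
  fix m assume "\<bar>m\<bar> \<le> int N"
  then have "\<bar>m + n\<bar> \<le> int (N + nat \<bar>n\<bar>)" by linarith
  then show "symbols (act n p) m = symbols (act n q) m"
    using assms unfolding close_def act_def by simp
qed

lemma continuous_on_act: "continuous_on (coded R) (act n)"
proof (rule continuous_on_coded)
  show "act n p \<in> codes" for p by (simp add: act_def)
  show "\<exists>M. \<forall>p\<in>coded R. \<forall>q\<in>coded R. close M p q \<longrightarrow> close N (act n p) (act n q)" for N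
    by (intro exI[of _ "N + nat \<bar>n\<bar>"] ballI impI act_close)
qed

lemma homeomorphic_map_act:
  assumes "invariant R"
  shows "homeomorphic_map (top_of_set (coded R)) (top_of_set (coded R)) (act n)"
proof -
  have "homeomorphic_maps (top_of_set (coded R)) (top_of_set (coded R)) (act n) (act (- n))"
    unfolding homeomorphic_maps_def
  proof (intro conjI ballI)
    have cont: "continuous_map (top_of_set (coded R)) (top_of_set (coded R)) (act n)" for n
      by (simp add: continuous_map_in_subtopology continuous_on_act act_coded[OF assms])
    show "continuous_map (top_of_set (coded R)) (top_of_set (coded R)) (act n)"
      "continuous_map (top_of_set (coded R)) (top_of_set (coded R)) (act (- n))" by (rule cont)+
  qed (simp_all add: act_add act_0[of _ R])
  then show ?thesis using homeomorphic_map_maps by blast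
qed

lemma cascade_act:
  assumes "invariant R" "closed (coded R)"
  shows "cascade (top_of_set (coded R)) (act 1)"
  using compact_coded[OF assms(2)] homeomorphic_map_act[OF assms(1)]
  by (simp add: cascade_def compact_space_subtopology Hausdorff_space_subtopology)

lemma zpow_act:
  assumes R: "invariant R" "closed (coded R)" and p: "p \<in> coded R"
  shows "zpow (top_of_set (coded R)) (act 1) n p = act n p"
proof (rule zpow_eqI[OF cascade_act[OF R]])
  show "act 1 (act n q) = act (n + 1) q" for n q by (simp add: act_add)
qed (use p in \<open>simp_all add: act_coded[OF R(1)] act_0[of _ R]\<close>)

lemma minimal_cascade_act:
  assumes R: "invariant R" "closed (coded R)" and ne: "coded R \<noteq> {}"
    and visit: "\<And>p q N. p \<in> coded R \<Longrightarrow> q \<in> coded R \<Longrightarrow> \<exists>n. close N (act n p) q"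
  shows "minimal_cascade (top_of_set (coded R)) (act 1)"
  unfolding minimal_cascade_def
proof (intro conjI ballI)
  fix p assume "p \<in> topspace (top_of_set (coded R))"
  then have p: "p \<in> coded R" by simp
  have orbit: "range (\<lambda>n. zpow (top_of_set (coded R)) (act 1) n p) = range (\<lambda>n. act n p)"
    using zpow_act[OF R p] by simp
  have "coded R \<subseteq> closure (range (\<lambda>n. act n p))"
  proof
    fix q assume q: "q \<in> coded R"
    obtain s where s: "\<And>N. close N (act (s N) p) q" using visit[OF p q] by metis
    have "(\<lambda>N. act (s N) p) \<longlonglongrightarrow> q"
    proof (rule tendsto_enc_iff[THEN iffD2])
      show "\<forall>N. eventually (\<lambda>i. close N (act (s i) p) q) sequentially"
        using s close_mono unfolding eventually_sequentially by blast
    qed (use q in \<open>auto simp: act_def intro: coded_codes\<close>)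
    then show "q \<in> closure (range (\<lambda>n. act n p))"
      unfolding closure_sequential by (intro exI[of _ "\<lambda>N. act (s N) p"]) simp
  qed
  then have dense: "coded R \<inter> closure (range (\<lambda>n. act n p)) = coded R" by blast
  have "coded R \<inter> range (\<lambda>n. act n p) = range (\<lambda>n. act n p)"
    using act_coded[OF R(1) p] by blast
  then show "top_of_set (coded R) closure_of range (\<lambda>n. zpow (top_of_set (coded R)) (act 1) n p)
      = topspace (top_of_set (coded R))"
    unfolding orbit by (simp add: closure_of_subtopology dense)
qed (use ne cascade_act[OF R] in simp_all)

lemma flow_hom_coded:
  assumes R: "invariant R" "closed (coded R)" and Q: "invariant Q" "closed (coded Q)"
    and maps: "\<And>p. p \<in> coded R \<Longrightarrow> f p \<in> coded Q"
    and equi: "\<And>p n. p \<in> coded R \<Longrightarrow> f (act n p) = act n (f p)"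
    and loc: "\<And>N. \<exists>M. \<forall>p\<in>coded R. \<forall>q\<in>coded R. close M p q \<longrightarrow> close N (f p) (f q)"
  shows "flow_hom (top_of_set (coded R)) (act 1) (top_of_set (coded Q)) (act 1) f"
  unfolding flow_hom_def
proof (intro conjI allI ballI)
  have "continuous_on (coded R) f"
    by (rule continuous_on_coded[OF _ loc]) (rule coded_codes[OF maps])
  then show "continuous_map (top_of_set (coded R)) (top_of_set (coded Q)) f"
    using maps by (auto simp: continuous_map_in_subtopology)
next
  fix n p assume "p \<in> topspace (top_of_set (coded R))"
  then have p: "p \<in> coded R" by simp
  show "f (zpow (top_of_set (coded R)) (act 1) n p)
      = zpow (top_of_set (coded Q)) (act 1) n (f p)"
    unfolding zpow_act[OF R p] zpow_act[OF Q maps[OF p]] by (rule equi[OF p])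
qed

section \<open>The two lowest binary digits\<close>

text \<open>
  The digits \<open>i < m\<close> are the positions of the two lowest ones in the binary expansion of \<open>z\<close>.
\<close>

definition low_bits :: "(nat \<Rightarrow> int) \<Rightarrow> nat \<Rightarrow> nat \<Rightarrow> bool" where
  "low_bits z i m \<longleftrightarrow> i < m \<and> z (Suc m) = 2 ^ i + 2 ^ m"

abbreviation integer_point :: "int \<Rightarrow> nat \<Rightarrow> int" where
  "integer_point c \<equiv> add_int c (\<lambda>_. 0)"

lemma zero_odometer [simp]: "(\<lambda>_. 0) \<in> odometer"
  by (simp add: odometer_def)

lemma integer_point_apply: "integer_point c k = c mod 2 ^ k"
  by (simp add: add_int_def)

lemma integer_point_inj:
  assumes "integer_point a = integer_point b"
  shows "a = b"
proof -
  define k where "k = nat \<bar>a - b\<bar>"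
  have "a mod 2 ^ k = b mod 2 ^ k"
    using fun_cong[OF assms, of k] by (simp add: integer_point_apply)
  then have "2 ^ k dvd a - b" by (simp add: mod_eq_dvd_iff)
  moreover have "\<bar>a - b\<bar> < 2 ^ k"
    using of_nat_less_two_power[of k, where ?'a = int] by (simp add: k_def)
  ultimately show ?thesis
    using zdvd_not_zless[of "\<bar>a - b\<bar>" "2 ^ k"] by (cases "a = b") auto
qed

lemma low_bits_sum_less: "i < m \<Longrightarrow> (2::int) ^ i + 2 ^ m < 2 ^ Suc m"
  using power_strict_increasing[of i m "2::int"] by simp

lemma odometer_Suc_cases:
  assumes "z \<in> odometer"
  shows "z (Suc k) = z k \<or> z (Suc k) = z k + 2 ^ k"
proof -
  have b: "0 \<le> z (Suc k)" "z (Suc k) < 2 * 2 ^ k"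
    using odometer_bounds[OF assms, of "Suc k"] by simp_all
  define d where "d = z (Suc k) div 2 ^ k"
  have d: "z (Suc k) = d * 2 ^ k + z k"
    using odometer_step[OF assms, of k] div_mult_mod_eq[of "z (Suc k)" "2 ^ k"] by (simp add: d_def)
  have "0 \<le> d" using b(1) by (simp add: d_def pos_imp_zdiv_nonneg_iff)
  moreover have "d < 2"
  proof (rule ccontr)
    assume "\<not> d < 2"
    then have "2 * 2 ^ k \<le> d * 2 ^ k" by (intro mult_right_mono) auto
    then show False using b(2) d odometer_bounds(1)[OF assms, of k] by linarith
  qed
  ultimately have "d = 0 \<or> d = 1" by linarith
  then show ?thesis using d by auto
qed

text \<open>
  A dyadic integer with fewer than two nonzero digits is \<open>0\<close> or a power of \<open>2\<close>. These are the
  points where the symbol is free.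
\<close>

lemma low_bits_or_power:
  assumes z: "z \<in> odometer" and none: "\<And>i m. \<not> low_bits z i m"
  obtains c where "z = integer_point c" "c = 0 \<or> (\<exists>i. c = 2 ^ i)"
proof (cases "\<exists>k. z k \<noteq> 0")
  case False
  then have "z = integer_point 0" by (auto simp: fun_eq_iff integer_point_apply)
  then show thesis using that by blast
next
  case True
  define K where "K = (LEAST k. z k \<noteq> 0)"
  have K: "z K \<noteq> 0" and below: "\<And>k. k < K \<Longrightarrow> z k = 0"
    using True LeastI_ex[OF True] not_less_Least unfolding K_def by blast+
  have "z 0 = 0" using odometer_bounds[OF z, of 0] by simp
  then obtain i where i: "K = Suc i" using K by (cases K) auto
  have zi: "z (Suc i) = 2 ^ i"
    using odometer_Suc_cases[OF z, of i] K below[of i] by (auto simp: i)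
  have tail: "z (Suc i + d) = 2 ^ i" for d
  proof (induction d)
    case 0
    then show ?case using zi by simp
  next
    case (Suc d)
    then show ?case
      using odometer_Suc_cases[OF z, of "Suc i + d"] none[of i "Suc i + d"]
      by (auto simp: low_bits_def)
  qed
  have "z k = 2 ^ i mod 2 ^ k" for k
  proof (cases "k \<le> i")
    case True
    then show ?thesis using below[of k] by (simp add: i le_imp_power_dvd)
  next
    case False
    then obtain d where d: "k = Suc i + d" using le_Suc_ex[of "Suc i" k] by auto
    have "(2::int) ^ i < 2 ^ k" using False by (intro power_strict_increasing) auto
    moreover have "z k = 2 ^ i" using tail[of d] by (simp only: d)
    ultimately show ?thesis by simp
  qed
  then have "z = integer_point (2 ^ i)" by (auto simp: fun_eq_iff integer_point_apply)
  then show thesis using that by blast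
qed

lemma low_bits_integer_point:
  "low_bits (integer_point c) i m \<longleftrightarrow> i < m \<and> c mod 2 ^ Suc m = 2 ^ i + 2 ^ m"
  by (simp add: low_bits_def integer_point_apply)

lemma power_mod_ne:
  assumes "i < m"
  shows "(2::int) ^ j mod 2 ^ Suc m \<noteq> 2 ^ i + 2 ^ m"
proof (cases "j \<le> m")
  case True
  then have "(2::int) ^ j < 2 ^ Suc m" by (intro power_strict_increasing) auto
  then have "(2::int) ^ j mod 2 ^ Suc m = 2 ^ j" by (intro mod_pos_pos_trivial) auto
  moreover have "(2::int) ^ j \<le> 2 ^ m" using True by (intro power_increasing) auto
  moreover have "(0::int) < 2 ^ i" by simp
  ultimately show ?thesis by linarith
next
  case False
  then have "(2::int) ^ j mod 2 ^ Suc m = 0" by (intro mod_eq_0_iff_dvd[THEN iffD2] le_imp_power_dvd) auto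
  moreover have "(0::int) < 2 ^ i" "(0::int) < 2 ^ m" by simp_all
  ultimately show ?thesis by linarith
qed

lemma not_low_bits_zero: "\<not> low_bits (\<lambda>_. 0) i m"
proof -
  have "(0::int) < 2 ^ i" "(0::int) < 2 ^ m" by simp_all
  then have "(0::int) \<noteq> 2 ^ i + 2 ^ m" by linarith
  then show ?thesis by (simp add: low_bits_def)
qed

lemma not_low_bits_power: "\<not> low_bits (integer_point (2 ^ j)) i m"
  using power_mod_ne by (simp add: low_bits_integer_point del: power_Suc)

text \<open>
  This makes the symbol prescribed at a position unambiguous. The larger residue determines the smaller one,
  which would otherwise have only one nonzero digit.
\<close>

lemma low_bits_unique:
  assumes z: "z \<in> odometer" and 1: "low_bits z i m" and 2: "low_bits z i' m'"
  shows "i = i'" "m = m'"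
proof -
  have no: False if "low_bits z i m" "low_bits z i' m'" "m < m'" for i i' m m'
  proof -
    have "z (Suc m) = z (Suc m') mod 2 ^ Suc m"
      using odometer_mod[OF z, of "Suc m" "Suc m'"] that(3) by simp
    also have "\<dots> = (2 ^ i' + 2 ^ m') mod 2 ^ Suc m"
      using that(2) by (simp add: low_bits_def)
    also have "\<dots> = 2 ^ i' mod 2 ^ Suc m"
    proof -
      have "(2::int) ^ Suc m dvd 2 ^ m'" using that(3) by (intro le_imp_power_dvd) auto
      then show ?thesis by (metis add.commute mod_add_self1 dvd_def mod_mult_self4 mult.commute)
    qed
    finally show False
      using power_mod_ne[of i m i'] that(1) by (simp add: low_bits_def del: power_Suc)
  qed
  show m: "m = m'" using no[OF 1 2] no[OF 2 1] by (metis linorder_less_linear)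
  show "i = i'" using 1 2 by (simp add: low_bits_def m)
qed

section \<open>The three spaces\<close>

text \<open>
  Any function of \<open>i\<close> and \<open>m\<close> would define a flow; \<^const>\<open>set_decode\<close> is taken because
  every finite pattern of values at small \<open>i\<close> occurs for arbitrarily large \<open>m\<close>.
\<close>

definition Yrel :: "(nat \<Rightarrow> int) \<Rightarrow> (int \<Rightarrow> bool) \<Rightarrow> bool" where
  "Yrel z y \<longleftrightarrow> (\<forall>n i m. low_bits (add_int n z) i m \<longrightarrow> y n = (i \<in> set_decode m))"

text \<open>
  Discrete derivative modulo \<open>2\<close>. A point of \<open>X\<close> is a primitive of a point of \<open>Y\<close>, so the
  cocycle of the two-point extension is hidden in the shift.
\<close>

definition diff :: "(int \<Rightarrow> bool) \<Rightarrow> int \<Rightarrow> bool" where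
  "diff x n \<longleftrightarrow> x (n + 1) \<noteq> x n"

definition Xrel :: "(nat \<Rightarrow> int) \<Rightarrow> (int \<Rightarrow> bool) \<Rightarrow> bool" where
  "Xrel z x \<longleftrightarrow> Yrel z (diff x)"

lemma YrelD: "Yrel z y \<Longrightarrow> low_bits (add_int n z) i m \<Longrightarrow> y n = (i \<in> set_decode m)"
  by (simp add: Yrel_def)

lemma closed_Y: "closed (coded Yrel)"
proof (rule closed_coded)
  fix z u
  assume z: "z \<in> odometer"
    and app: "\<And>N. \<exists>z' u'. z' \<in> odometer \<and> Yrel z' u' \<and> close N (enc z' u') (enc z u)"
  show "Yrel z u"
    unfolding Yrel_def
  proof (intro allI impI)
    fix n i m assume lb: "low_bits (add_int n z) i m"
    obtain z' u' where z': "Yrel z' u'" "close (max (Suc m) (nat \<bar>n\<bar>)) (enc z' u') (enc z u)"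
      using app by blast
    then have "z' (Suc m) = z (Suc m)" and u: "u' n = u n" by (auto simp: close_def)
    then have "low_bits (add_int n z') i m" using lb by (simp add: low_bits_def add_int_def)
    from YrelD[OF z'(1) this] show "u n = (i \<in> set_decode m)" by (simp add: u)
  qed
qed

lemma invariant_Y: "invariant Yrel"
  unfolding invariant_def Yrel_def by (simp add: add.commute)

lemma Yrel_exists:
  assumes "z \<in> odometer"
  obtains y where "Yrel z y"
proof
  show "Yrel z (\<lambda>n. \<exists>i m. low_bits (add_int n z) i m \<and> i \<in> set_decode m)"
    unfolding Yrel_def using low_bits_unique add_int_odometer[OF assms] by blast
qed

text \<open>
  The primitive at \<open>n\<close> is the parity of the number of ones between \<open>0\<close> and \<open>n\<close>.
\<close>

lemma diff_surj: obtains x where "diff x = y"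
proof -
  define x where "x n = odd (card {j. y j \<and> (0 \<le> j \<and> j < n \<or> n \<le> j \<and> j < 0)})" for n
  let ?J = "\<lambda>n. {j. y j \<and> (0 \<le> j \<and> j < n \<or> n \<le> j \<and> j < 0)}"
  have fin: "finite (?J n)" for n
    by (rule finite_subset[of _ "{- \<bar>n\<bar>..\<bar>n\<bar>}"]) auto
  have "diff x n = y n" for n
  proof (cases "0 \<le> n")
    case True
    then have "?J (n + 1) = (if y n then insert n (?J n) else ?J n)" by (auto simp: le_less)
    moreover have "n \<notin> ?J n" using True by auto
    ultimately show ?thesis using fin[of n] by (simp add: diff_def x_def)
  next
    case False
    then have "?J n = (if y n then insert n (?J (n + 1)) else ?J (n + 1))"
      by (auto simp: not_le order_le_less)
    moreover have "n \<notin> ?J (n + 1)" using False by auto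
    ultimately show ?thesis using fin[of "n + 1"] by (simp add: diff_def x_def)
  qed
  then show thesis using that by blast
qed

text \<open>
  Every window of a point of \<open>Y\<close> is also the window of an integer \<open>a\<close> at which all symbols are forced by digits
  below \<open>M\<close>. If some symbol of the window is free, then \<open>z\<close> is an integer \<open>c\<close>, and
  \<open>a = c + 2 ^ m + 2 ^ m'\<close> with large \<open>m < m'\<close>: the set coded by \<open>m\<close> prescribes the symbols at the positions
  where \<open>c + j\<close> is a power of \<open>2\<close>, and the set coded by \<open>m'\<close> the symbol where \<open>c + j = 0\<close>.
\<close>

lemma determined_approximation:
  assumes z: "z \<in> odometer" and y: "Yrel z y"
  obtains a M where "N \<le> M" "\<And>k. k \<le> N \<Longrightarrow> a mod 2 ^ k = z k"
    "\<And>j. \<bar>j\<bar> \<le> int N \<Longrightarrow>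
      \<exists>i m. i < m \<and> m < M \<and> (a + j) mod 2 ^ Suc m = 2 ^ i + 2 ^ m \<and> y j = (i \<in> set_decode m)"
proof -
  have "\<forall>j\<in>{- int N..int N}. \<exists>B. \<forall>i m. low_bits (add_int j z) i m \<longrightarrow> m < B"
    using low_bits_unique(2)[OF add_int_odometer[OF z]] by (metis lessI)
  then obtain B where B: "\<And>j i m. j \<in> {- int N..int N} \<Longrightarrow> low_bits (add_int j z) i m \<Longrightarrow> m < B j"
    by metis
  define L where "L = Max (insert N (B ` {- int N..int N}))"
  have LN: "N \<le> L" by (simp add: L_def)
  have L: "m < L" if "\<bar>j\<bar> \<le> int N" "low_bits (add_int j z) i m" for j i m
  proof -
    have j: "j \<in> {- int N..int N}" using that(1) by auto
    then have "m < B j" using B that(2) by blast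
    also have "\<dots> \<le> L" unfolding L_def using j by (intro Max_ge) auto
    finally show ?thesis .
  qed
  show thesis
  proof (cases "\<forall>j. \<bar>j\<bar> \<le> int N \<longrightarrow> (\<exists>i m. low_bits (add_int j z) i m)")
    case True
    show thesis
    proof (rule that[of L "z L"])
      show "z L mod 2 ^ k = z k" if "k \<le> N" for k
        using odometer_mod[OF z, of k L] that LN by simp
      fix j assume j: "\<bar>j\<bar> \<le> int N"
      then obtain i m where im: "low_bits (add_int j z) i m" using True by blast
      have "(z L + j) mod 2 ^ Suc m = (z (Suc m) + j) mod 2 ^ Suc m"
        using odometer_mod[OF z, of "Suc m" L] L[OF j im] by (metis Suc_leI mod_add_left_eq)
      then show "\<exists>i m. i < m \<and> m < L \<and> (z L + j) mod 2 ^ Suc m = 2 ^ i + 2 ^ m \<and>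
          y j = (i \<in> set_decode m)"
        using im L[OF j im] YrelD[OF y im] by (auto simp: low_bits_def add_int_def)
    qed (rule LN)
  next
    case False
    then obtain j0 where "\<And>i m. \<not> low_bits (add_int j0 z) i m" by blast
    then obtain s where s: "add_int j0 z = integer_point s"
      using low_bits_or_power[OF add_int_odometer[OF z]] by blast
    define c where "c = s - j0"
    have zc: "z = integer_point c"
      using arg_cong[OF s, of "add_int (- j0)"] z by (simp add: c_def)
    \<comment> \<open>Every power of \<open>2\<close> of the form \<open>c + j\<close> with \<open>j\<close> in the window has exponent below \<open>K\<close>.
      The element \<open>K\<close> of the set coded by \<open>m\<close> serves only to make \<open>m\<close> large.\<close>
    define K where "K = L + nat (\<bar>c\<bar> + int N)"
    define m where "m = set_encode (insert K {i. i < K \<and> y (2 ^ i - c)})"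
    define m' where "m' = (if y (- c) then 2 ^ m else 2 ^ Suc m :: nat)"
    have dm: "set_decode m = insert K {i. i < K \<and> y (2 ^ i - c)}"
      unfolding m_def by (rule set_encode_inverse) simp
    have "set_encode {K} \<le> m"
      unfolding m_def set_encode_def by (rule sum_mono2) auto
    then have "2 ^ K \<le> m" by simp
    then have Km: "K < m" using less_exp[of K] by linarith
    have dm': "set_decode m' = (if y (- c) then {m} else {Suc m})"
      unfolding m'_def using set_encode_inverse[of "{m}"] set_encode_inverse[of "{Suc m}"] by simp
    have mm': "m < m'"
      unfolding m'_def using less_exp[of m] Suc_lessD[OF less_exp[of "Suc m"]] by (simp del: power_Suc)
    define a :: int where "a = c + 2 ^ m + 2 ^ m'"
    have amod: "(a + j) mod 2 ^ k = (c + j) mod 2 ^ k" if "k \<le> m" for k j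
    proof -
      have "(2::int) ^ k dvd 2 ^ m + 2 ^ m'" using that mm' by (intro dvd_add le_imp_power_dvd) auto
      then have "2 ^ k dvd (a + j) - (c + j)" by (simp add: a_def add.assoc)
      then show ?thesis by (simp add: mod_eq_dvd_iff)
    qed
    show thesis
    proof (rule that[of "Suc m'" a])
      show "N \<le> Suc m'" using LN Km mm' by (simp add: K_def)
      show "a mod 2 ^ k = z k" if "k \<le> N" for k
        using amod[of k 0] that LN Km by (simp add: zc integer_point_apply K_def)
      fix j assume j: "\<bar>j\<bar> \<le> int N"
      show "\<exists>i m. i < m \<and> m < Suc m' \<and> (a + j) mod 2 ^ Suc m = 2 ^ i + 2 ^ m \<and>
          y j = (i \<in> set_decode m)"
      proof (cases "\<exists>i m0. low_bits (add_int j z) i m0")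
        case True
        then obtain i m0 where im: "low_bits (add_int j z) i m0" by blast
        then have "i < m0" "(c + j) mod 2 ^ Suc m0 = 2 ^ i + 2 ^ m0"
          by (simp_all add: zc low_bits_integer_point)
        moreover have "Suc m0 \<le> m" using L[OF j im] Km by (simp add: K_def)
        ultimately show ?thesis
          using amod[of "Suc m0" j] YrelD[OF y im] mm'
          by (intro exI[of _ i] exI[of _ m0]) (simp del: power_Suc)
      next
        case False
        then obtain t where t: "add_int j z = integer_point t" "t = 0 \<or> (\<exists>i. t = 2 ^ i)"
          using low_bits_or_power[OF add_int_odometer[OF z]] by blast
        have cj: "c + j = t" using t(1) by (intro integer_point_inj) (simp add: zc)
        from t(2) show ?thesis
        proof
          assume "t = 0"
          then have j: "j = - c" using cj by simp
          have "(2 ^ m + 2 ^ m') mod 2 ^ Suc m' = (2 ^ m + 2 ^ m' :: int)"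
            by (intro mod_pos_pos_trivial low_bits_sum_less[OF mm']) simp
          moreover have "y j = (m \<in> set_decode m')" using dm' j by simp
          ultimately show ?thesis
            using mm' by (intro exI[of _ m] exI[of _ m']) (simp add: a_def j del: power_Suc)
        next
          assume "\<exists>i. t = 2 ^ i"
          then obtain i where i: "c + j = 2 ^ i" using cj by blast
          have "int i < 2 ^ i" using less_exp[of i] by (metis of_nat_less_iff of_nat_numeral of_nat_power)
          then have iK: "i < K" using i j unfolding K_def by linarith
          have "(2::int) ^ Suc m dvd 2 ^ m'" using mm' by (intro le_imp_power_dvd) auto
          moreover have "a + j = 2 ^ i + 2 ^ m + 2 ^ m'" using i by (simp add: a_def)
          ultimately have "(a + j) mod 2 ^ Suc m = (2 ^ i + 2 ^ m) mod 2 ^ Suc m"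
            by (simp add: mod_eq_dvd_iff del: power_Suc)
          also have "\<dots> = 2 ^ i + 2 ^ m"
            using low_bits_sum_less[of i m] iK Km by (intro mod_pos_pos_trivial) auto
          finally have "(a + j) mod 2 ^ Suc m = 2 ^ i + 2 ^ m" .
          moreover have "y j = (i \<in> set_decode m)"
          proof -
            have "2 ^ i - c = j" using i by simp
            then show ?thesis using iK by (simp add: dm)
          qed
          ultimately show ?thesis
            using iK Km mm' by (intro exI[of _ i] exI[of _ m]) (simp del: power_Suc)
        qed
      qed
    qed
  qed
qed

text \<open>
  Any \<open>n\<close> with \<open>z + n \<equiv> a\<close> modulo \<open>2 ^ M\<close> works, where \<open>a\<close> is the integer of
  \<open>determined_approximation\<close>. The whole residue class is recorded because visits arbitrarily far in both
  directions are needed in \<open>both_signs\<close>.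
\<close>

lemma visit_Y:
  assumes z: "z \<in> odometer" "Yrel z y" and w: "w \<in> odometer" "Yrel w v"
  obtains r M where "\<And>t. close N (act (r + 2 ^ M * t) (enc z y)) (enc w v)"
proof -
  obtain a M where M: "N \<le> M" and a: "\<And>k. k \<le> N \<Longrightarrow> a mod 2 ^ k = w k"
    and target: "\<And>j. \<bar>j\<bar> \<le> int N \<Longrightarrow>
      \<exists>i m. i < m \<and> m < M \<and> (a + j) mod 2 ^ Suc m = 2 ^ i + 2 ^ m \<and> v j = (i \<in> set_decode m)"
    using determined_approximation[OF w] by metis
  have shift: "add_int (a - z M + 2 ^ M * t + j) z k = (a + j) mod 2 ^ k" if "k \<le> M" for k t j
  proof -
    have "add_int (a - z M + 2 ^ M * t + j) z k
        = (z M mod 2 ^ k + (a - z M + 2 ^ M * t + j)) mod 2 ^ k"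
      using odometer_mod[OF z(1) that] by (simp add: add_int_def)
    also have "\<dots> = (z M + (a - z M + 2 ^ M * t + j)) mod 2 ^ k" by (rule mod_add_left_eq)
    also have "\<dots> = (a + j) mod 2 ^ k"
    proof -
      have "(2::int) ^ k dvd 2 ^ M * t" using that by (intro dvd_mult2 le_imp_power_dvd)
      then show ?thesis by (simp add: mod_eq_dvd_iff)
    qed
    finally show ?thesis .
  qed
  have "close N (act (a - z M + 2 ^ M * t) (enc z y)) (enc w v)" for t
    unfolding close_def
  proof (intro conjI allI impI)
    fix k assume "k \<le> N"
    then show "base (act (a - z M + 2 ^ M * t) (enc z y)) k = base (enc w v) k"
      using shift[of k t 0] a M by simp
  next
    fix j assume "\<bar>j\<bar> \<le> int N"
    from target[OF this] obtain i m where im: "i < m" "m < M"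
      "(a + j) mod 2 ^ Suc m = 2 ^ i + 2 ^ m" "v j = (i \<in> set_decode m)" by blast
    have "low_bits (add_int (a - z M + 2 ^ M * t + j) z) i m"
      unfolding low_bits_def using im shift[of "Suc m" t j] by simp
    from YrelD[OF z(2) this] im(4)
    show "symbols (act (a - z M + 2 ^ M * t) (enc z y)) j = symbols (enc w v) j"
      by (simp add: add.commute)
  qed
  then show thesis by (rule that)
qed

lemma XrelD: "Xrel z x \<Longrightarrow> low_bits (add_int n z) i m \<Longrightarrow> diff x n = (i \<in> set_decode m)"
  by (simp add: Xrel_def YrelD)

lemma closed_X: "closed (coded Xrel)"
proof (rule closed_coded)
  fix z u
  assume z: "z \<in> odometer"
    and app: "\<And>N. \<exists>z' u'. z' \<in> odometer \<and> Xrel z' u' \<and> close N (enc z' u') (enc z u)"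
  show "Xrel z u"
    unfolding Xrel_def Yrel_def
  proof (intro allI impI)
    fix n i m assume lb: "low_bits (add_int n z) i m"
    obtain z' u' where z': "Xrel z' u'" "close (max (Suc m) (nat \<bar>n\<bar> + 1)) (enc z' u') (enc z u)"
      using app by blast
    then have "z' (Suc m) = z (Suc m)" and u: "u' n = u n" "u' (n + 1) = u (n + 1)"
      by (auto simp: close_def)
    then have "low_bits (add_int n z') i m" using lb by (simp add: low_bits_def add_int_def)
    from XrelD[OF z'(1) this] show "diff u n = (i \<in> set_decode m)" by (simp add: u diff_def)
  qed
qed

lemma diff_shift: "diff (\<lambda>m. x (m + n)) = (\<lambda>m. diff x (m + n))"
  by (simp add: diff_def fun_eq_iff add_ac)

lemma invariant_X: "invariant Xrel"
  using invariant_Y by (simp add: invariant_def Xrel_def diff_shift)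

lemma diff_flip: "diff (\<lambda>n. x n \<noteq> b) = diff x"
  by (auto simp: diff_def fun_eq_iff)

lemma Xrel_flip: "Xrel z x \<Longrightarrow> Xrel z (\<lambda>n. x n \<noteq> b)"
  by (simp only: Xrel_def diff_flip)

lemma Xrel_exists:
  assumes "z \<in> odometer"
  obtains x where "Xrel z x"
  using Yrel_exists[OF assms] diff_surj unfolding Xrel_def by metis

section \<open>Minimality\<close>

text \<open>
  Equal differences propagate agreement or disagreement from each position to its neighbours.
\<close>

lemma diff_window:
  assumes d: "\<And>j. \<bar>j\<bar> \<le> int N \<Longrightarrow> diff x (j + n) = diff v j" and j: "\<bar>j\<bar> \<le> int N"
  shows "x (j + n) = (v j \<noteq> (x n \<noteq> v 0))"
proof -
  define e where "e j \<longleftrightarrow> x (j + n) \<noteq> v j" for j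
  have step: "e (j + 1) = e j" if "\<bar>j\<bar> \<le> int N" for j
    using d[OF that] by (auto simp: e_def diff_def algebra_simps)
  have pos: "k \<le> N \<Longrightarrow> e (int k) = e 0" for k
  proof (induction k)
    case (Suc k)
    then show ?case using step[of "int k"] by (simp add: add.commute)
  qed simp
  have neg: "k \<le> N \<Longrightarrow> e (- int k) = e 0" for k
  proof (induction k)
    case (Suc k)
    then show ?case using step[of "- int (Suc k)"] by simp
  qed simp
  have "e j = e 0"
    using pos[of "nat j"] neg[of "nat (- j)"] j by (cases "0 \<le> j") auto
  then show ?thesis by (auto simp: e_def)
qed

lemma visit_X_up_to_flip:
  assumes z: "z \<in> odometer" "Xrel z x" and w: "w \<in> odometer" "Xrel w v"
  obtains r M where "\<And>t k. k \<le> N \<Longrightarrow> add_int (r + 2 ^ M * t) z k = w k"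
    "\<And>t. \<exists>b. \<forall>j. \<bar>j\<bar> \<le> int N \<longrightarrow> x (j + (r + 2 ^ M * t)) = (v j \<noteq> b)"
proof -
  obtain r M where c: "\<And>t. close N (act (r + 2 ^ M * t) (enc z (diff x))) (enc w (diff v))"
    using visit_Y z w unfolding Xrel_def by metis
  show thesis
  proof (rule that)
    show "add_int (r + 2 ^ M * t) z k = w k" if "k \<le> N" for t k
      using c[of t] that by (simp add: close_def)
    fix t
    have "diff x (j + (r + 2 ^ M * t)) = diff v j" if "\<bar>j\<bar> \<le> int N" for j
      using c[of t] that by (simp add: close_def)
    from diff_window[of N, OF this]
    show "\<exists>b. \<forall>j. \<bar>j\<bar> \<le> int N \<longrightarrow> x (j + (r + 2 ^ M * t)) = (v j \<noteq> b)"
      by blast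
  qed
qed

text \<open>
  Over \<open>0\<close> the differences are free at \<open>0\<close> and at the powers of \<open>2\<close>, so a point may be flipped by any
  function that changes only there.
\<close>

lemma Xrel_zero_modify:
  assumes x: "Xrel (\<lambda>_. 0) x"
    and b: "\<And>n. b (n + 1) \<noteq> b n \<Longrightarrow> n = 0 \<or> (\<exists>i. n = 2 ^ i)"
  shows "Xrel (\<lambda>_. 0) (\<lambda>n. x n \<noteq> b n)"
  unfolding Xrel_def Yrel_def
proof (intro allI impI)
  fix n i m assume lb: "low_bits (integer_point n) i m"
  then have "n \<noteq> 0" "\<And>i. n \<noteq> 2 ^ i" using not_low_bits_zero not_low_bits_power by auto
  then have "b (n + 1) = b n" using b by blast
  then have "diff (\<lambda>n. x n \<noteq> b n) n = diff x n" by (auto simp: diff_def)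
  then show "diff (\<lambda>n. x n \<noteq> b n) n = (i \<in> set_decode m)" using XrelD[OF x lb] by simp
qed

text \<open>
  Choose visits \<open>a < 0 < b\<close> of a point over \<open>0\<close> to the window of \<open>v\<close> up to flip. If they have equal signs, flip
  the point on the positive half line, which the free symbol at \<open>0\<close> permits: the sign at \<open>b\<close> changes, the one at
  \<open>a\<close> does not.
\<close>

lemma both_signs:
  assumes w: "w \<in> odometer" "Xrel w v"
  obtains s n1 n2 where "Xrel (\<lambda>_. 0) s"
    "\<And>k. k \<le> N \<Longrightarrow> integer_point n1 k = w k" "\<And>k. k \<le> N \<Longrightarrow> integer_point n2 k = w k"
    "\<And>j. \<bar>j\<bar> \<le> int N \<Longrightarrow> s (j + n1) = v j" "\<And>j. \<bar>j\<bar> \<le> int N \<Longrightarrow> s (j + n2) = (\<not> v j)"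
proof -
  obtain x where x: "Xrel (\<lambda>_. 0) x" by (rule Xrel_exists[OF zero_odometer])
  obtain r M where base: "\<And>t k. k \<le> N \<Longrightarrow> integer_point (r + 2 ^ M * t) k = w k"
    and sym: "\<And>t. \<exists>b. \<forall>j. \<bar>j\<bar> \<le> int N \<longrightarrow> x (j + (r + 2 ^ M * t)) = (v j \<noteq> b)"
    using visit_X_up_to_flip[OF zero_odometer x w, of N] by metis
  define K where "K = int N + 1 + \<bar>r\<bar>"
  define a where "a = r + 2 ^ M * (- K)"
  define b where "b = r + 2 ^ M * K"
  have "1 * K \<le> 2 ^ M * K" by (intro mult_right_mono) (auto simp: K_def)
  moreover have "a = r - 2 ^ M * K" "b = r + 2 ^ M * K" by (simp_all add: a_def b_def)
  ultimately have ab: "a \<le> - int N" "int N < b" using K_def by linarith+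
  obtain \<alpha> where \<alpha>: "\<And>j. \<bar>j\<bar> \<le> int N \<Longrightarrow> x (j + a) = (v j \<noteq> \<alpha>)"
    using sym unfolding a_def by blast
  obtain \<beta> where \<beta>: "\<And>j. \<bar>j\<bar> \<le> int N \<Longrightarrow> x (j + b) = (v j \<noteq> \<beta>)"
    using sym unfolding b_def by blast
  \<comment> \<open>Flip the right half line exactly if both visits have the same sign.\<close>
  define s where "s n \<longleftrightarrow> x n \<noteq> (0 < n \<and> \<alpha> = \<beta>)" for n
  have s: "Xrel (\<lambda>_. 0) s"
    unfolding s_def by (rule Xrel_zero_modify[OF x]) (auto simp: le_less)
  have sa: "s (j + a) = (v j \<noteq> \<alpha>)" if "\<bar>j\<bar> \<le> int N" for j
    using \<alpha>[OF that] that ab by (auto simp: s_def)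
  have sb: "s (j + b) = (v j = \<alpha>)" if "\<bar>j\<bar> \<le> int N" for j
    using \<beta>[OF that] that ab by (auto simp: s_def)
  have basea: "integer_point a k = w k" and baseb: "integer_point b k = w k" if "k \<le> N" for k
    unfolding a_def b_def by (rule base[OF that])+
  show thesis
  proof (cases \<alpha>)
    case True
    then show thesis using that[OF s baseb basea] sa sb by auto
  next
    case False
    then show thesis using that[OF s basea baseb] sa sb by auto
  qed
qed

text \<open>
  First visit, up to flip, a long window of the point of \<open>both_signs\<close>; this window contains both the window of
  \<open>v\<close> and its flip, and one of the two has the right sign.
\<close>

lemma visit_X:
  assumes z: "z \<in> odometer" "Xrel z x" and w: "w \<in> odometer" "Xrel w v"
  shows "\<exists>n. close N (act n (enc z x)) (enc w v)"
proof -
  obtain s n1 n2 where s: "Xrel (\<lambda>_. 0) s"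
    and base: "\<And>k. k \<le> N \<Longrightarrow> integer_point n1 k = w k" "\<And>k. k \<le> N \<Longrightarrow> integer_point n2 k = w k"
    and sym: "\<And>j. \<bar>j\<bar> \<le> int N \<Longrightarrow> s (j + n1) = v j" "\<And>j. \<bar>j\<bar> \<le> int N \<Longrightarrow> s (j + n2) = (\<not> v j)"
    using both_signs[OF w, of N] by metis
  define N' where "N' = N + nat \<bar>n1\<bar> + nat \<bar>n2\<bar>"
  obtain r M where zb: "\<And>t k. k \<le> N' \<Longrightarrow> add_int (r + 2 ^ M * t) z k = 0"
    and xb: "\<And>t. \<exists>b. \<forall>j. \<bar>j\<bar> \<le> int N' \<longrightarrow> x (j + (r + 2 ^ M * t)) = (s j \<noteq> b)"
    using visit_X_up_to_flip[OF z zero_odometer s, of N'] by metis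
  have zr: "add_int r z k = 0" if "k \<le> N'" for k using zb[OF that, of 0] by simp
  obtain b where b: "\<And>j. \<bar>j\<bar> \<le> int N' \<Longrightarrow> x (j + r) = (s j \<noteq> b)"
    using xb[of 0] by auto
  define n where "n = (if b then n2 else n1)"
  have n: "\<bar>n\<bar> \<le> \<bar>n1\<bar> + \<bar>n2\<bar>" by (simp add: n_def)
  have "close N (act (r + n) (enc z x)) (enc w v)"
    unfolding close_def
  proof (intro conjI allI impI)
    fix k assume k: "k \<le> N"
    then have "k \<le> N'" by (simp add: N'_def)
    then have "add_int n (add_int r z) k = integer_point n k"
      using zr[of k] by (simp only: add_int_def[of n] N'_def)
    then show "base (act (r + n) (enc z x)) k = base (enc w v) k"
      using base k by (simp add: n_def)
  next
    fix j assume j: "\<bar>j\<bar> \<le> int N"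
    then have "\<bar>j + n\<bar> \<le> int N'" using n unfolding N'_def by linarith
    from b[OF this] have "x (j + (r + n)) = (s (j + n) \<noteq> b)" by (simp add: add_ac)
    then show "symbols (act (r + n) (enc z x)) j = symbols (enc w v) j"
      using sym[OF j] by (simp add: n_def)
  qed
  then show ?thesis by blast
qed

lemma minimal_X: "minimal_cascade (top_of_set (coded Xrel)) (act 1)"
proof (rule minimal_cascade_act[OF invariant_X closed_X])
  obtain x where "Xrel (\<lambda>_. 0) x" by (rule Xrel_exists[OF zero_odometer])
  then have "enc (\<lambda>_. 0) x \<in> coded Xrel" by simp
  then show "coded Xrel \<noteq> {}" by blast
  show "\<exists>n. close N (act n p) q" if "p \<in> coded Xrel" "q \<in> coded Xrel" for p q N
    using that visit_X by (metis codedE)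
qed

lemma minimal_Y: "minimal_cascade (top_of_set (coded Yrel)) (act 1)"
proof (rule minimal_cascade_act[OF invariant_Y closed_Y])
  obtain y where "Yrel (\<lambda>_. 0) y" by (rule Yrel_exists[OF zero_odometer])
  then have "enc (\<lambda>_. 0) y \<in> coded Yrel" by simp
  then show "coded Yrel \<noteq> {}" by blast
  show "\<exists>n. close N (act n p) q" if "p \<in> coded Yrel" "q \<in> coded Yrel" for p q N
    using that visit_Y by (metis codedE)
qed

text \<open>
  The odometer itself, with a constant dummy sequence, so that it is a coded space as well.
\<close>

definition Zrel :: "(nat \<Rightarrow> int) \<Rightarrow> (int \<Rightarrow> bool) \<Rightarrow> bool" where
  "Zrel z u \<longleftrightarrow> u = (\<lambda>_. False)"

lemma closed_Z: "closed (coded Zrel)"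
proof (rule closed_coded)
  fix z u
  assume app: "\<And>N. \<exists>z' u'. z' \<in> odometer \<and> Zrel z' u' \<and> close N (enc z' u') (enc z u)"
  have "\<not> u n" for n
    using app[of "nat \<bar>n\<bar>"] by (auto simp: Zrel_def close_def)
  then show "Zrel z u" by (simp add: Zrel_def fun_eq_iff)
qed

lemma invariant_Z: "invariant Zrel"
  by (simp add: invariant_def Zrel_def)

lemma minimal_Z: "minimal_cascade (top_of_set (coded Zrel)) (act 1)"
proof (rule minimal_cascade_act[OF invariant_Z closed_Z])
  have "enc (\<lambda>_. 0) (\<lambda>_. False) \<in> coded Zrel" by (simp add: Zrel_def)
  then show "coded Zrel \<noteq> {}" by blast
  fix p q N assume "p \<in> coded Zrel" "q \<in> coded Zrel"
  then obtain z w where z: "p = enc z (\<lambda>_. False)" "z \<in> odometer"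
    and w: "q = enc w (\<lambda>_. False)" "w \<in> odometer"
    by (auto simp: Zrel_def elim!: codedE)
  have "add_int (w N - z N) z k = w k" if "k \<le> N" for k
  proof -
    have "add_int (w N - z N) z k = (z N mod 2 ^ k + (w N - z N)) mod 2 ^ k"
      using odometer_mod[OF z(2) that] by (simp add: add_int_def)
    also have "\<dots> = w N mod 2 ^ k" by (simp add: mod_add_left_eq)
    finally show ?thesis using odometer_mod[OF w(2) that] by simp
  qed
  then show "\<exists>n. close N (act n p) q" by (intro exI[of _ "w N - z N"]) (simp add: z w close_def)
qed

section \<open>The tower\<close>

lemma openin_coded:
  assumes U: "U \<subseteq> coded R" and R: "closed (coded R)"
    and loc: "\<And>p. p \<in> U \<Longrightarrow> \<exists>N. \<forall>q\<in>coded R. close N q p \<longrightarrow> q \<in> U"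
  shows "openin (top_of_set (coded R)) U"
proof -
  have "closed (coded R \<inter> - U)"
    unfolding closed_sequential_limits
  proof (intro allI impI, elim conjE)
    fix s l assume s: "\<forall>n. s n \<in> coded R \<inter> - U" and lim: "s \<longlonglongrightarrow> l"
    have l: "l \<in> coded R" using R s lim unfolding closed_sequential_limits by blast
    have ev: "\<forall>N. eventually (\<lambda>n. close N (s n) l) sequentially"
      by (rule tendsto_enc_iff[THEN iffD1, OF _ _ lim]) (use s l in \<open>blast intro: coded_codes\<close>)+
    have "l \<notin> U"
    proof
      assume "l \<in> U"
      then obtain N where N: "\<forall>q\<in>coded R. close N q l \<longrightarrow> q \<in> U" using loc by blast
      obtain n where "close N (s n) l"
        using eventually_happens'[OF sequentially_bot ev[rule_format, of N]] by blast
      then show False using N s by blast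
    qed
    then show "l \<in> coded R \<inter> - U" using l by blast
  qed
  then have "closedin (top_of_set (coded R)) (coded R - U)"
    by (metis Diff_eq closed_subset Diff_subset)
  then show ?thesis using U by (metis closedin_def double_diff openin_subset subset_refl topspace_euclidean_subtopology)
qed

lemma close_trans: "close N p q \<Longrightarrow> close N q r \<Longrightarrow> close N p r"
  by (simp add: close_def)

lemma diag_nbhd_close:
  assumes R: "closed (coded R)"
  shows "diag_nbhd (top_of_set (coded R)) {(p, q) \<in> coded R \<times> coded R. close N p q}"
  unfolding diag_nbhd_def
proof (intro conjI exI)
  let ?U = "{(p, q) \<in> coded R \<times> coded R. close N p q}"
  let ?B = "\<lambda>p. {q \<in> coded R. close N q p}"
  have B: "openin (top_of_set (coded R)) (?B p)" for p
    by (rule openin_coded[OF _ R]) (auto intro: close_trans)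
  show "openin (prod_topology (top_of_set (coded R)) (top_of_set (coded R))) ?U"
    unfolding openin_prod_topology_alt
  proof (intro allI impI)
    fix p q assume pq: "(p, q) \<in> ?U"
    have "?B p \<times> ?B q \<subseteq> ?U" using pq by (auto simp: close_def)
    moreover have "p \<in> ?B p" "q \<in> ?B q" using pq by (auto simp: close_def)
    ultimately show "\<exists>V W. openin (top_of_set (coded R)) V \<and> openin (top_of_set (coded R)) W \<and>
        p \<in> V \<and> q \<in> W \<and> V \<times> W \<subseteq> ?U"
      using B by blast
  qed
qed (auto simp: close_def)

text \<open>
  Otherwise pairs outside \<open>A\<close> that agree on ever larger windows would accumulate at a point of the diagonal, by
  compactness.
\<close>

lemma diag_nbhd_uniform:
  assumes R: "closed (coded R)" and A: "diag_nbhd (top_of_set (coded R)) A"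
  obtains N where "\<And>p q. p \<in> coded R \<Longrightarrow> q \<in> coded R \<Longrightarrow> close N p q \<Longrightarrow> (p, q) \<in> A"
proof (rule ccontr)
  assume no: "\<not> thesis"
  have "\<forall>N. \<exists>p q. p \<in> coded R \<and> q \<in> coded R \<and> close N p q \<and> (p, q) \<notin> A"
    using no that by blast
  then obtain s t where st: "\<And>N. s N \<in> coded R" "\<And>N. t N \<in> coded R" "\<And>N. close N (s N) (t N)"
    "\<And>N. (s N, t N) \<notin> A" by metis
  obtain l r where l: "l \<in> coded R" "strict_mono r" "(s \<circ> r) \<longlonglongrightarrow> l"
    using compact_coded[OF R] st(1) unfolding compact_def by metis
  have ev: "\<forall>N. eventually (\<lambda>n. close N ((s \<circ> r) n) l) sequentially"
    by (rule tendsto_enc_iff[THEN iffD1, OF _ _ l(3)])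
      (use st(1) l(1) in \<open>auto intro: coded_codes\<close>)
  have "(t \<circ> r) \<longlonglongrightarrow> l"
  proof (rule tendsto_enc_iff[THEN iffD2])
    show "\<forall>N. eventually (\<lambda>n. close N ((t \<circ> r) n) l) sequentially"
    proof
      fix N show "eventually (\<lambda>n. close N ((t \<circ> r) n) l) sequentially"
        using ev[rule_format, of N] eventually_ge_at_top[of N]
      proof eventually_elim
        case (elim n)
        have "N \<le> r n" using elim(2) seq_suble[OF l(2), of n] by linarith
        then have "close N (t (r n)) (s (r n))" using close_mono close_sym st(3) by blast
        then show ?case using elim(1) close_trans by (auto simp: o_def)
      qed
    qed
  qed (use st(2) l(1) in \<open>auto intro: coded_codes\<close>)
  obtain U where U: "openin (prod_topology (top_of_set (coded R)) (top_of_set (coded R))) U"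
    "(l, l) \<in> U" "U \<subseteq> A"
    using A l(1) unfolding diag_nbhd_def by auto
  then obtain V W where VW: "openin (top_of_set (coded R)) V" "openin (top_of_set (coded R)) W"
    "l \<in> V" "l \<in> W" "V \<times> W \<subseteq> U"
    unfolding openin_prod_topology_alt by meson
  have *: "eventually (\<lambda>n. f n \<in> V) sequentially"
    if f: "f \<longlonglongrightarrow> l" "\<And>n. f n \<in> coded R" and V: "openin (top_of_set (coded R)) V" "l \<in> V" for f V
  proof -
    obtain O' where O: "open O'" "V = coded R \<inter> O'" using V(1) unfolding openin_open by blast
    then have "eventually (\<lambda>n. f n \<in> O') sequentially" using f(1) V(2) topological_tendstoD by blast
    then show ?thesis by (rule eventually_mono) (use f(2) O(2) in blast)
  qed
  have "eventually (\<lambda>n. s (r n) \<in> V) sequentially"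
    using *[OF l(3) _ VW(1,3)] st(1) by (simp add: o_def)
  moreover have "eventually (\<lambda>n. t (r n) \<in> W) sequentially"
    using *[OF \<open>(t \<circ> r) \<longlonglongrightarrow> l\<close> _ VW(2,4)] st(2) by (simp add: o_def)
  ultimately have "eventually (\<lambda>n. s (r n) \<in> V \<and> t (r n) \<in> W) sequentially"
    by (rule eventually_conj)
  then obtain n where "s (r n) \<in> V" "t (r n) \<in> W"
    using eventually_happens'[OF sequentially_bot] by blast
  then show False using VW(5) U(3) st(4) by blast
qed

definition YofX :: "point \<Rightarrow> point" where
  "YofX p = enc (base p) (diff (symbols p))"

definition ZofY :: "point \<Rightarrow> point" where
  "ZofY p = enc (base p) (\<lambda>_. False)"

lemma flow_hom_YofX:
  "flow_hom (top_of_set (coded Xrel)) (act 1) (top_of_set (coded Yrel)) (act 1) YofX"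
proof (rule flow_hom_coded[OF invariant_X closed_X invariant_Y closed_Y])
  show "YofX p \<in> coded Yrel" if "p \<in> coded Xrel" for p
    using that by (auto simp: YofX_def Xrel_def elim!: codedE)
  show "YofX (act n p) = act n (YofX p)" for n p
    by (simp add: YofX_def act_def diff_shift)
  fix N
  have "close N (YofX p) (YofX q)" if "close (N + 1) p q" for p q
    using that by (auto simp: close_def YofX_def diff_def)
  then show "\<exists>M. \<forall>p\<in>coded Xrel. \<forall>q\<in>coded Xrel. close M p q \<longrightarrow> close N (YofX p) (YofX q)"
    by blast
qed

lemma flow_hom_ZofY:
  "flow_hom (top_of_set (coded Yrel)) (act 1) (top_of_set (coded Zrel)) (act 1) ZofY"
proof (rule flow_hom_coded[OF invariant_Y closed_Y invariant_Z closed_Z])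
  show "ZofY p \<in> coded Zrel" if "p \<in> coded Yrel" for p
    using that by (auto simp: ZofY_def Zrel_def elim!: codedE)
  show "ZofY (act n p) = act n (ZofY p)" for n p
    by (simp add: ZofY_def act_def)
  fix N
  have "close N (ZofY p) (ZofY q)" if "close N p q" for p q
    using that by (auto simp: close_def ZofY_def)
  then show "\<exists>M. \<forall>p\<in>coded Yrel. \<forall>q\<in>coded Yrel. close M p q \<longrightarrow> close N (ZofY p) (ZofY q)"
    by blast
qed

text \<open>
  Points of a fibre that have the same symbol at \<open>0\<close> are equal.
\<close>

lemma equicontinuous_YofX:
  "equicontinuous_ext (top_of_set (coded Xrel)) (act 1) YofX"
  unfolding equicontinuous_ext_def
proof (intro allI impI)
  let ?X = "top_of_set (coded Xrel)"
  fix A assume A: "diag_nbhd ?X A"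
  let ?B = "{(p, q) \<in> coded Xrel \<times> coded Xrel. close 0 p q}"
  have "(zpow ?X (act 1) n p, zpow ?X (act 1) n q) \<in> A"
    if pq: "(p, q) \<in> ?B \<inter> fibre_relation ?X YofX" for n p q
  proof -
    have p: "p \<in> coded Xrel" and q: "q \<in> coded Xrel" and cl: "close 0 p q" and eq: "YofX p = YofX q"
      using pq by (auto simp: fibre_relation_def)
    obtain z x where p': "p = enc z x" using p by (rule codedE)
    obtain w v where q': "q = enc w v" using q by (rule codedE)
    have zw: "z = w" and d: "diff x = diff v" using eq by (simp_all add: p' q' YofX_def)
    have "x 0 = v 0" using cl by (simp add: close_def p' q')
    then have "x j = v j" for j
      using diff_window[of "nat \<bar>j\<bar>" x 0 v j] d by simp
    then have "p = q" by (auto simp: p' q' zw)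
    moreover have "zpow ?X (act 1) n p \<in> coded Xrel"
      using zpow_act[OF invariant_X closed_X p] act_coded[OF invariant_X p] by simp
    ultimately show ?thesis using A by (auto simp: diag_nbhd_def)
  qed
  then show "\<exists>B. diag_nbhd ?X B \<and> (\<forall>n. \<forall>(p, q)\<in>B \<inter> fibre_relation ?X YofX.
      (zpow ?X (act 1) n p, zpow ?X (act 1) n q) \<in> A)"
    using diag_nbhd_close[OF closed_X, of 0] by (intro exI[of _ ?B]) blast
qed

text \<open>
  Adding an integer preserves agreement of residues.
\<close>

lemma equicontinuous_Z:
  "equicontinuous_ext (top_of_set (coded Zrel)) (act 1) f"
  unfolding equicontinuous_ext_def
proof (intro allI impI)
  let ?Z = "top_of_set (coded Zrel)"
  fix A assume A: "diag_nbhd ?Z A"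
  obtain N where N: "\<And>p q. p \<in> coded Zrel \<Longrightarrow> q \<in> coded Zrel \<Longrightarrow> close N p q \<Longrightarrow> (p, q) \<in> A"
    using diag_nbhd_uniform[OF closed_Z A] by blast
  let ?B = "{(p, q) \<in> coded Zrel \<times> coded Zrel. close N p q}"
  have "(zpow ?Z (act 1) n p, zpow ?Z (act 1) n q) \<in> A" if pq: "(p, q) \<in> ?B" for n p q
  proof -
    have p: "p \<in> coded Zrel" and q: "q \<in> coded Zrel" using pq by auto
    have "symbols p = (\<lambda>_. False)" "symbols q = (\<lambda>_. False)"
      using p q by (auto simp: Zrel_def elim!: codedE)
    then have "close N (act n p) (act n q)" using pq by (simp add: close_def act_def add_int_def)
    then show ?thesis
      using zpow_act[OF invariant_Z closed_Z] act_coded[OF invariant_Z] p q N by simp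
  qed
  then show "\<exists>B. diag_nbhd ?Z B \<and> (\<forall>n. \<forall>(p, q)\<in>B \<inter> fibre_relation ?Z f.
      (zpow ?Z (act 1) n p, zpow ?Z (act 1) n q) \<in> A)"
    using diag_nbhd_close[OF closed_Z, of N] by (intro exI[of _ ?B]) blast
qed

text \<open>
  If the symbols at \<open>n\<close> can differ, then \<open>z + n\<close> is a nonnegative integer; this fails for all sufficiently
  small \<open>n\<close>, since the integer increases with \<open>n\<close>.
\<close>

lemma fibre_negatively_asymptotic:
  assumes z: "z \<in> odometer" and y: "Yrel z y" "Yrel z y'"
  obtains D where "\<And>n. n < D \<Longrightarrow> y n = y' n"
proof (cases "y = y'")
  case True
  then show thesis using that by blast
next
  case False
  have free: "\<exists>c\<ge>0. add_int n z = integer_point c" if ne: "y n \<noteq> y' n" for n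
  proof -
    have "\<not> low_bits (add_int n z) i m" for i m
      using YrelD[OF y(1)] YrelD[OF y(2)] ne by blast
    then obtain c where "add_int n z = integer_point c" "c = 0 \<or> (\<exists>i. c = 2 ^ i)"
      using low_bits_or_power[OF add_int_odometer[OF z]] by blast
    moreover from this(2) have "c \<ge> 0" by auto
    ultimately show ?thesis by blast
  qed
  from False obtain n0 where "y n0 \<noteq> y' n0" by blast
  then obtain c0 where c0: "add_int n0 z = integer_point c0" using free by blast
  show thesis
  proof (rule that[of "n0 - c0"])
    fix n assume n: "n < n0 - c0"
    show "y n = y' n"
    proof (rule ccontr)
      assume "y n \<noteq> y' n"
      then obtain c where c: "c \<ge> 0" "add_int n z = integer_point c" using free by blast
      have "integer_point (c + (n0 - n)) = integer_point c0"
        using arg_cong[OF c(2), of "add_int (n0 - n)"] c0 by simp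
      then have "c + (n0 - n) = c0" by (rule integer_point_inj)
      then show False using n c(1) by linarith
    qed
  qed
qed

text \<open>
  Along a suitable sequence of times tending to \<open>-\<infinity>\<close> one point of the pair converges, and the other
  point follows it.
\<close>

lemma proximal_ZofY:
  "proximal_ext (top_of_set (coded Yrel)) (act 1) ZofY"
  unfolding proximal_ext_def
proof safe
  let ?Y = "top_of_set (coded Yrel)"
  fix p q assume pq: "(p, q) \<in> fibre_relation ?Y ZofY"
  have p: "p \<in> coded Yrel" and q: "q \<in> coded Yrel" and eq: "ZofY p = ZofY q"
    using pq by (auto simp: fibre_relation_def)
  obtain z y where p': "p = enc z y" "z \<in> odometer" "Yrel z y" using p by (rule codedE)
  obtain w y' where q': "q = enc w y'" "Yrel w y'" using q by (rule codedE)
  have zw: "w = z" using eq by (simp add: p' q' ZofY_def)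
  obtain D where D: "\<And>n. n < D \<Longrightarrow> y n = y' n"
    using fibre_negatively_asymptotic[OF p'(2,3)] q'(2) zw by blast
  let ?s = "\<lambda>j. act (- int j) p" and ?t = "\<lambda>j. act (- int j) q"
  have s: "?s j \<in> coded Yrel" and t: "?t j \<in> coded Yrel" for j
    using act_coded[OF invariant_Y] p q by blast+
  obtain l r where l: "l \<in> coded Yrel" "strict_mono r" "(?s \<circ> r) \<longlonglongrightarrow> l"
    using compact_coded[OF closed_Y] s unfolding compact_def by metis
  have ev: "\<forall>N. eventually (\<lambda>n. close N ((?s \<circ> r) n) l) sequentially"
    by (rule tendsto_enc_iff[THEN iffD1, OF _ _ l(3)]) (use s l(1) in \<open>auto intro: coded_codes\<close>)
  have lt: "(?t \<circ> r) \<longlonglongrightarrow> l"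
  proof (rule tendsto_enc_iff[THEN iffD2])
    show "\<forall>N. eventually (\<lambda>n. close N ((?t \<circ> r) n) l) sequentially"
    proof
      fix N show "eventually (\<lambda>n. close N ((?t \<circ> r) n) l) sequentially"
        using ev[rule_format, of N] eventually_gt_at_top[of "nat (int N - D)"]
      proof eventually_elim
        case (elim n)
        have "int N - D < int (r n)" using elim(2) seq_suble[OF l(2), of n] by linarith
        then have "y (m - int (r n)) = y' (m - int (r n))" if "\<bar>m\<bar> \<le> int N" for m
          using that by (intro D) linarith
        then have "close N (?t (r n)) (?s (r n))" by (simp add: close_def p' q' zw)
        then show ?case using elim(1) close_trans by (auto simp: o_def)
      qed
    qed
  qed (use t l(1) in \<open>auto intro: coded_codes\<close>)
  show "proximal_pair ?Y (act 1) p q"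
    unfolding proximal_pair_def
  proof (intro exI conjI)
    let ?F = "filtermap (\<lambda>n. - int (r n)) sequentially"
    show "?F \<noteq> bot" by (simp add: filtermap_bot_iff)
    have "limitin ?Y (\<lambda>n. zpow ?Y (act 1) n a) l ?F"
      if a: "a \<in> coded Yrel" and lim: "((\<lambda>j. act (- int j) a) \<circ> r) \<longlonglongrightarrow> l" for a
    proof -
      have z: "zpow ?Y (act 1) n a = act n a" for n
        by (rule zpow_act[OF invariant_Y closed_Y a])
      have "filterlim (\<lambda>n. act n a) (nhds l) ?F"
        using lim by (simp add: filterlim_def filtermap_filtermap o_def)
      then show ?thesis
        using l(1) act_coded[OF invariant_Y a] by (simp add: limitin_subtopology z)
    qed
    from this[OF p l(3)] this[OF q lt]
    show "limitin ?Y (\<lambda>n. zpow ?Y (act 1) n p) l ?F" "limitin ?Y (\<lambda>n. zpow ?Y (act 1) n q) l ?F" .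
  qed
qed

definition origin :: point where
  "origin = enc (\<lambda>_. 0) (\<lambda>_. False)"

lemma cascade_point: "cascade (top_of_set {a}) id" for a :: "'a::metric_space"
  by (simp add: cascade_def compact_space_subtopology Hausdorff_space_subtopology)

lemma zpow_point: "zpow (top_of_set {a}) id n a = a" for a :: "'a::metric_space"
  by (rule zpow_eqI[OF cascade_point, where act = "\<lambda>n x. x"]) auto

lemma minimal_point: "minimal_cascade (top_of_set {a}) id" for a :: "'a::metric_space"
proof -
  have "range (\<lambda>n. zpow (top_of_set {a}) id n a) = {a}" by (auto simp: zpow_point)
  then show ?thesis
    by (simp add: minimal_cascade_def cascade_point closure_of_subtopology)
qed

lemma flow_hom_point:
  "flow_hom X T (top_of_set {a}) id (\<lambda>_. a)" for a :: "'a::metric_space"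
  by (simp add: flow_hom_def zpow_point)

lemma not_homeomorphic_map:
  assumes "p \<in> topspace X" "q \<in> topspace X" "p \<noteq> q" "f p = f q"
  shows "\<not> homeomorphic_map X Y f"
  using assms unfolding homeomorphic_map_def inj_on_def by blast

text \<open>
  The three factor maps are not injective: the odometer has more than one point, the symbol at \<open>0\<close>
  over \<open>z = 0\<close> is free, and flipping is invisible in \<open>Y\<close>.
\<close>

lemma PI_of_order_3: "PI_of_order 3 (top_of_set (coded Xrel)) (act 1)"
proof -
  let ?W = "\<lambda>i. [top_of_set {origin}, top_of_set (coded Zrel), top_of_set (coded Yrel),
      top_of_set (coded Xrel)] ! i"
  let ?S = "\<lambda>i. [id, act 1, act 1, act 1] ! i"
  let ?f = "\<lambda>i. [\<lambda>_. origin, ZofY, YofX] ! i"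
  obtain y where y: "Yrel (\<lambda>_. 0) y" by (rule Yrel_exists[OF zero_odometer])
  have y': "Yrel (\<lambda>_. 0) (\<lambda>n. y n \<noteq> (n = 0))"
    unfolding Yrel_def
  proof (intro allI impI)
    fix n i m assume lb: "low_bits (integer_point n) i m"
    then have "n \<noteq> 0" using not_low_bits_zero by auto
    then show "(y n \<noteq> (n = 0)) = (i \<in> set_decode m)" using YrelD[OF y lb] by simp
  qed
  obtain x where x: "Xrel (\<lambda>_. 0) x" by (rule Xrel_exists[OF zero_odometer])
  have 0: "\<not> homeomorphic_map (top_of_set (coded Zrel)) (top_of_set {origin}) (\<lambda>_. origin)"
  proof (rule not_homeomorphic_map)
    have "integer_point 1 1 \<noteq> (\<lambda>_. 0) 1" by (simp add: integer_point_apply)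
    then show "enc (integer_point 1) (\<lambda>_. False) \<noteq> origin" by (auto simp: origin_def)
  qed (simp_all add: origin_def Zrel_def add_int_odometer)
  have 1: "\<not> homeomorphic_map (top_of_set (coded Yrel)) (top_of_set (coded Zrel)) ZofY"
  proof (rule not_homeomorphic_map)
    show "enc (\<lambda>_. 0) y \<noteq> enc (\<lambda>_. 0) (\<lambda>n. y n \<noteq> (n = 0))" by (auto dest: fun_cong[where x = 0])
  qed (use y y' in \<open>simp_all add: ZofY_def\<close>)
  have 2: "\<not> homeomorphic_map (top_of_set (coded Xrel)) (top_of_set (coded Yrel)) YofX"
  proof (rule not_homeomorphic_map)
    show "enc (\<lambda>_. 0) x \<noteq> enc (\<lambda>_. 0) (\<lambda>n. x n \<noteq> True)" by (auto dest: fun_cong[where x = 0])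
    show "YofX (enc (\<lambda>_. 0) x) = YofX (enc (\<lambda>_. 0) (\<lambda>n. x n \<noteq> True))"
      unfolding YofX_def base_enc symbols_enc diff_flip ..
    show "enc (\<lambda>_. 0) (\<lambda>n. x n \<noteq> True) \<in> topspace (top_of_set (coded Xrel))"
      using Xrel_flip[OF x, of True] by simp
  qed (use x in simp)
  have "minimal_cascade (?W i) (?S i)" if "i \<le> 3" for i
  proof -
    have "i = 0 \<or> i = 1 \<or> i = 2 \<or> i = 3" using that by linarith
    then show ?thesis
      by (auto simp: minimal_point minimal_X minimal_Y minimal_Z eval_nat_numeral)
  qed
  moreover have "flow_hom (?W (Suc i)) (?S (Suc i)) (?W i) (?S i) (?f i) \<and>
      \<not> homeomorphic_map (?W (Suc i)) (?W i) (?f i) \<and>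
      (proximal_ext (?W (Suc i)) (?S (Suc i)) (?f i) \<or>
       equicontinuous_ext (?W (Suc i)) (?S (Suc i)) (?f i))" if "i < 3" for i
  proof -
    have "i = 0 \<or> i = 1 \<or> i = 2" using that by linarith
    then show ?thesis
      using 0 1 2 flow_hom_point flow_hom_ZofY flow_hom_YofX equicontinuous_Z[of "\<lambda>_. origin"]
        equicontinuous_YofX proximal_ZofY
      by (auto simp: eval_nat_numeral)
  qed
  ultimately show ?thesis
    unfolding PI_of_order_def
    by (intro exI[of _ ?W] exI[of _ ?S] exI[of _ ?f]) (simp add: eval_nat_numeral)
qed

section \<open>Counting minimal left ideals\<close>

text \<open>
  The classical independent family: an index codes a length \<open>m\<close> and a list of binary words, and the
  index belongs to the set attached to \<open>A\<close> if the characteristic word of \<open>A\<close> of length \<open>m\<close> is in the list.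
  A further component of the code makes the indices as large as desired.
\<close>

lemma independent_family:
  "\<exists>ind :: nat set \<Rightarrow> nat \<Rightarrow> bool. \<forall>\<A> \<C> t. finite \<A> \<longrightarrow> (\<exists>i\<ge>t. \<forall>A\<in>\<A>. ind A i = (A \<in> \<C>))"
proof -
  let ?tr = "\<lambda>m A. map (\<lambda>j::nat. j \<in> A) [0..<m]"
  let ?code = "\<lambda>i. from_nat (fst (prod_decode i)) :: nat \<times> bool list list"
  let ?ind = "\<lambda>A i. ?tr (fst (?code i)) A \<in> set (snd (?code i))"
  have "\<exists>i\<ge>t. \<forall>A\<in>\<A>. ?ind A i = (A \<in> \<C>)" if fin: "finite \<A>" for \<A> \<C> :: "nat set set" and t
  proof -
    have "\<exists>j::nat. A \<noteq> B \<longrightarrow> (j \<in> A) \<noteq> (j \<in> B)" for A B by auto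
    then obtain d :: "nat set \<Rightarrow> nat set \<Rightarrow> nat"
      where d: "\<And>A B. A \<noteq> B \<Longrightarrow> (d A B \<in> A) \<noteq> (d A B \<in> B)" by metis
    define m where "m = Suc (Max (insert 0 (case_prod d ` (\<A> \<times> \<A>))))"
    have dm: "d A B < m" if "A \<in> \<A>" "B \<in> \<A>" for A B
      unfolding m_def using fin that by (intro le_imp_less_Suc Max_ge) auto
    have tr_inj: "A = B" if "A \<in> \<A>" "B \<in> \<A>" "?tr m A = ?tr m B" for A B
      using d[of A B] dm[OF that(1,2)] that(3) by (auto simp: map_eq_conv)
    have "finite (?tr m ` (\<A> \<inter> \<C>))" using fin by blast
    then obtain L where L: "set L = ?tr m ` (\<A> \<inter> \<C>)" using finite_list by blast
    define i where "i = prod_encode (to_nat (m, L), t)"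
    have code: "?code i = (m, L)" by (simp add: i_def)
    have "?ind A i = (A \<in> \<C>)" if "A \<in> \<A>" for A
      unfolding code fst_conv snd_conv L using that tr_inj by blast
    moreover have "t \<le> i" by (simp add: i_def le_prod_encode_2)
    ultimately show ?thesis by blast
  qed
  then show ?thesis by (intro exI[of _ ?ind]) blast
qed

definition gap_function :: "(nat \<Rightarrow> bool) \<Rightarrow> int \<Rightarrow> bool" where
  "gap_function \<beta> n \<longleftrightarrow> (\<exists>i. 2 ^ i < n \<and> n \<le> 2 ^ Suc i \<and> \<beta> i)"

lemma gap_function_value:
  assumes "2 ^ i < n" "n \<le> 2 ^ Suc i"
  shows "gap_function \<beta> n = \<beta> i"
proof -
  have "k = i" if k: "2 ^ k < n" "n \<le> 2 ^ Suc k" for k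
  proof -
    have "(2::int) ^ k < 2 ^ Suc i" "(2::int) ^ i < 2 ^ Suc k" using assms k by linarith+
    then have "k < Suc i" "i < Suc k" by (simp_all del: power_Suc)
    then show ?thesis by simp
  qed
  then show ?thesis using assms unfolding gap_function_def by blast
qed

lemma gap_function_change:
  assumes "gap_function \<beta> (n + 1) \<noteq> gap_function \<beta> n"
  shows "\<exists>i. n = 2 ^ i"
proof (rule ccontr)
  assume "\<nexists>i. n = 2 ^ i"
  then have ne: "n \<noteq> 2 ^ i" for i by blast
  have "(2 ^ i < n + 1 \<and> n + 1 \<le> 2 ^ Suc i) = (2 ^ i < n \<and> n \<le> 2 ^ Suc i)" for i
    using ne[of i] ne[of "Suc i"] by auto
  then show False using assms unfolding gap_function_def by (metis (no_types, lifting))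
qed

lemma close_coordinate:
  "\<exists>N. \<forall>p\<in>codes. \<forall>q\<in>codes. close N p q \<longrightarrow> p j = q j"
proof (rule enc_coordinate_cases[of j])
  fix k assume k: "\<And>z u. enc z u j = of_int (z k)"
  show ?thesis
  proof (intro exI[of _ k] ballI impI)
    fix p q assume "p \<in> codes" "q \<in> codes" "close k p q"
    then show "p j = q j"
      using k[of "base p" "symbols p"] k[of "base q" "symbols q"] codes_decode
      by (simp add: close_def)
  qed
next
  fix n assume n: "\<And>z u. enc z u j = of_bool (u n)"
  show ?thesis
  proof (intro exI[of _ "nat \<bar>n\<bar>"] ballI impI)
    fix p q assume "p \<in> codes" "q \<in> codes" "close (nat \<bar>n\<bar>) p q"
    then show "p j = q j"
      using n[of "base p" "symbols p"] n[of "base q" "symbols q"] codes_decode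
      by (simp add: close_def)
  qed
qed

lemma continuous_map_coordinate: "continuous_map (top_of_set S) euclideanreal (\<lambda>p::point. p j)"
  using continuous_on_product_then_coordinatewise[OF continuous_on_id, of S j] by simp

text \<open>
  \<open>L \<C>\<close> is the closed left ideal attached to \<open>\<C>\<close>, and \<open>b s\<close> is the base point flipped according to \<open>s\<close>. The
  finite intersection property is witnessed by the iterate \<open>n = 2 ^ i + 2 ^ (i - 1)\<close>, the middle of
  the \<open>i\<close>-th gap, for an index \<open>i\<close> at which the finitely many \<open>ind A\<close> involved agree with \<open>\<C>\<close>.
\<close>

lemma lepoll_minimal_left_ideals:
  fixes X defines "X \<equiv> top_of_set (coded Xrel)"
  shows "(UNIV :: nat set set set) \<lesssim> {I. minimal_left_ideal X (act 1) I}"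
proof -
  let ?E = "enveloping_semigroup X (act 1)"
  have X: "cascade X (act 1)" unfolding X_def by (rule cascade_act[OF invariant_X closed_X])
  have tX: "topspace X = coded Xrel" by (simp add: X_def)
  obtain ind :: "nat set \<Rightarrow> nat \<Rightarrow> bool"
    where ind: "\<And>\<A> \<C> t. finite \<A> \<Longrightarrow> \<exists>i\<ge>t. \<forall>A\<in>\<A>. ind A i = (A \<in> \<C>)"
    using independent_family by metis
  obtain x where x: "Xrel (\<lambda>_. 0) x" by (rule Xrel_exists[OF zero_odometer])
  define a where "a A = enc (\<lambda>_. 0) (\<lambda>n. x n \<noteq> gap_function (ind A) n)" for A
  define b where "b s = enc (\<lambda>_. 0) (\<lambda>n. x n \<noteq> s)" for s
  have a: "a A \<in> coded Xrel" for A
  proof -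
    have "Xrel (\<lambda>_. 0) (\<lambda>n. x n \<noteq> gap_function (ind A) n)"
      by (rule Xrel_zero_modify[OF x]) (use gap_function_change in blast)
    then show ?thesis by (simp add: a_def)
  qed
  have b: "b s \<in> coded Xrel" for s using Xrel_flip[OF x, of s] by (simp add: b_def)
  have eval: "continuous_map (selfmaps X) euclideanreal (\<lambda>f. f p j)" if "p \<in> coded Xrel" for p j
    using continuous_map_compose[OF continuous_map_eval continuous_map_coordinate] that
    by (simp add: tX X_def o_def)
  let ?G = "\<lambda>\<C> (A, j). {f \<in> topspace (selfmaps X). f (a A) j = f (b (A \<in> \<C>)) j}"
  have G: "closedin (selfmaps X) (?G \<C> P)" for \<C> P
    using closedin_continuous_maps_eq[OF _ eval[OF a] eval[OF b]] by (cases P) simp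
  define L where "L \<C> = {f \<in> ?E. \<forall>A. f (a A) = f (b (A \<in> \<C>))}" for \<C>
  have L: "L \<C> = ?E \<inter> \<Inter>(range (?G \<C>))" for \<C>
    using enveloping_semigroup_subset[of X "act 1"] by (auto simp: L_def fun_eq_iff)
  have closed_L: "closedin (selfmaps X) (L \<C>)" for \<C>
    unfolding L using G by (intro closedin_Int closedin_enveloping_semigroup closedin_Inter) auto
  have meet: "?E \<inter> \<Inter>(?G \<C> ` J) \<noteq> {}" if J: "finite J" for \<C> J
  proof -
    obtain N where N: "\<And>p q j. p \<in> codes \<Longrightarrow> q \<in> codes \<Longrightarrow> close (N j) p q \<Longrightarrow> p j = q j"
      using close_coordinate by metis
    define t where "t = Max (insert 0 ((N \<circ> snd) ` J))"
    have t: "N j \<le> t" if "(A, j) \<in> J" for A j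
      unfolding t_def using J that by (intro Max_ge) (auto simp: rev_image_eqI)
    obtain i where i: "t + 1 \<le> i" "\<And>A. A \<in> fst ` J \<Longrightarrow> ind A i = (A \<in> \<C>)"
      using ind[of "fst ` J" "t + 1" \<C>] J by auto
    obtain k where k: "i = Suc k" "t \<le> k" using i(1) by (cases i) auto
    \<comment> \<open>The distance of \<open>n\<close> from both ends of the gap is \<open>2 ^ k\<close>, more than the radius \<open>t\<close>.\<close>
    define n :: int where "n = 2 ^ i + 2 ^ k"
    have "int k < 2 ^ k" using less_exp[of k] by (metis of_nat_less_iff of_nat_numeral of_nat_power)
    have near: "2 ^ i < m + n \<and> m + n \<le> 2 ^ Suc i" if "\<bar>m\<bar> \<le> int t" for m
    proof -
      have "\<bar>m\<bar> < 2 ^ k" using that k(2) \<open>int k < 2 ^ k\<close> by linarith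
      then show ?thesis unfolding n_def k(1) power_Suc by linarith
    qed
    let ?f = "restrict (zpow X (act 1) n) (topspace X)"
    have act: "?f p = act n p" if "p \<in> coded Xrel" for p
      using that zpow_act[OF invariant_X closed_X that] by (simp add: tX X_def)
    have "?f (a A) j = ?f (b (A \<in> \<C>)) j" if Aj: "(A, j) \<in> J" for A j
    proof -
      have "ind A i = (A \<in> \<C>)" using i(2) Aj by force
      then have "close t (act n (a A)) (act n (b (A \<in> \<C>)))"
        using gap_function_value[of i _ "ind A"] near by (simp add: close_def a_def b_def)
      then have "close (N j) (act n (a A)) (act n (b (A \<in> \<C>)))" using close_mono t[OF Aj] by blast
      then show ?thesis
        unfolding act[OF a] act[OF b] by (rule N[rotated 2]) (simp_all add: act_def)
    qed
    then have "?f \<in> ?G \<C> P" if "P \<in> J" for P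
      using that restrict_zpow_in_selfmaps[OF X, of n] by (cases P) simp
    then have "?f \<in> ?E \<inter> \<Inter>(?G \<C> ` J)"
      using restrict_zpow_in_enveloping_semigroup[OF X, of n] by blast
    then show ?thesis by blast
  qed
  have ne_L: "L \<C> \<noteq> {}" for \<C>
  proof -
    have "compactin (selfmaps X) ?E"
      by (simp add: closedin_compact_space closedin_enveloping_semigroup selfmaps_compact_Hausdorff[OF X])
    then have fip: "?E \<inter> \<Inter>\<U> \<noteq> {}"
      if "\<forall>K\<in>\<U>. closedin (selfmaps X) K" "\<forall>\<F>. finite \<F> \<and> \<F> \<subseteq> \<U> \<longrightarrow> ?E \<inter> \<Inter>\<F> \<noteq> {}" for \<U>
      using that by (simp add: compactin_fip)
    have "?E \<inter> \<Inter>(range (?G \<C>)) \<noteq> {}"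
    proof (rule fip; intro allI ballI impI)
      fix K assume "K \<in> range (?G \<C>)"
      then obtain P where "K = ?G \<C> P" by (rule rangeE)
      then show "closedin (selfmaps X) K" using G by simp
    next
      fix \<F> assume "finite \<F> \<and> \<F> \<subseteq> range (?G \<C>)"
      then obtain J where "finite J" "\<F> = ?G \<C> ` J"
        using finite_subset_image[of \<F> "?G \<C>" UNIV] by auto
      then show "?E \<inter> \<Inter>\<F> \<noteq> {}" using meet[of J \<C>] by simp
    qed
    then show ?thesis by (simp add: L)
  qed
  have ideal_L: "left_ideal X (act 1) (L \<C>)" for \<C>
    unfolding left_ideal_def
  proof (intro conjI ballI)
    show "L \<C> \<noteq> {}" by (rule ne_L)
    show "L \<C> \<subseteq> ?E" unfolding L_def by blast
    fix p q assume "p \<in> ?E" "q \<in> L \<C>"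
    then show "compose (topspace X) p q \<in> L \<C>"
      using enveloping_semigroup_compose[OF X] a b by (simp add: L_def compose_def tX)
  qed
  have sep: "f (b True) \<noteq> f (b False)" if f: "f \<in> ?E" for f
  proof
    assume eq: "f (b True) = f (b False)"
    \<comment> \<open>Coordinate \<open>1\<close> holds the symbol at position \<open>0\<close>; the iterates keep the two symbols complementary.\<close>
    have "f (b True) 1 + f (b False) 1 = 1"
    proof (rule enveloping_semigroup_induct[OF f _ X])
      show "closedin (selfmaps X) {f \<in> topspace (selfmaps X). f (b True) 1 + f (b False) 1 = 1}"
        using closedin_continuous_maps_eq[of euclideanreal "selfmaps X" "\<lambda>f. f (b True) 1 + f (b False) 1" "\<lambda>_. 1"]
          continuous_map_add[OF eval[OF b] eval[OF b]] by simp
      fix n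
      have "zpow X (act 1) n (b s) = act n (b s)" for s
        unfolding X_def by (rule zpow_act[OF invariant_X closed_X b])
      then show "restrict (zpow X (act 1) n) (topspace X) (b True) 1 +
          restrict (zpow X (act 1) n) (topspace X) (b False) 1 = 1"
        using b by (simp add: tX) (simp add: b_def enc_def)
    qed
    then have "2 * f (b True) 1 = 1" using eq by simp
    moreover have "f (b True) \<in> coded Xrel"
      using selfmaps_apply[OF subsetD[OF enveloping_semigroup_subset f], of "b True"] b
      by (simp add: tX)
    then obtain z u where "f (b True) = enc z u" by (rule codedE)
    ultimately have "2 * enc z u 1 = 1" by simp
    then show False by (simp add: enc_def of_bool_def split: if_splits)
  qed
  have "\<exists>I. minimal_left_ideal X (act 1) I \<and> I \<subseteq> L \<C>" for \<C>
    by (rule exists_minimal_left_ideal[OF X ideal_L closed_L]) blast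
  then obtain I where I: "\<And>\<C>. minimal_left_ideal X (act 1) (I \<C>)" "\<And>\<C>. I \<C> \<subseteq> L \<C>" by metis
  have "inj I"
  proof (rule injI)
    fix \<C> \<D> assume eq: "I \<C> = I \<D>"
    have "I \<C> \<noteq> {}" using I(1)[of \<C>] by (simp add: minimal_left_ideal_def left_ideal_def)
    then obtain f where "f \<in> L \<C>" "f \<in> L \<D>" using I(2)[of \<C>] I(2)[of \<D>] eq by blast
    then have f: "f \<in> ?E" and "\<And>A. f (a A) = f (b (A \<in> \<C>))" "\<And>A. f (a A) = f (b (A \<in> \<D>))"
      by (simp_all add: L_def)
    then have same: "f (b (A \<in> \<C>)) = f (b (A \<in> \<D>))" for A by metis
    have "(A \<in> \<C>) = (A \<in> \<D>)" for A
      using sep[OF f] same[of A] by (cases "A \<in> \<C>"; cases "A \<in> \<D>") simp_all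
    then show "\<C> = \<D>" by blast
  qed
  moreover have "range I \<subseteq> {I. minimal_left_ideal X (act 1) I}" using I(1) by auto
  ultimately show ?thesis unfolding lepoll_def by (intro exI[of _ I] conjI)
qed

text \<open>
  An ideal is recovered from one of its elements, and an element from its graph. A pair of points of
  \<^const>\<open>codes\<close> is coded by a set of natural numbers.
\<close>

lemma minimal_left_ideals_lepoll:
  assumes X: "cascade X T" and codes: "topspace X \<subseteq> codes"
  shows "{I. minimal_left_ideal X T I} \<lesssim> (UNIV :: nat set set set)"
proof -
  let ?E = "enveloping_semigroup X T"
  let ?\<kappa> = "\<lambda>(p::point) (q::point). range (\<lambda>j. prod_encode (j, prod_encode (int_encode \<lfloor>p j\<rfloor>, int_encode \<lfloor>q j\<rfloor>)))"
  have \<kappa>: "p = p' \<and> q = q'"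
    if "p \<in> codes" "q \<in> codes" "p' \<in> codes" "q' \<in> codes" "?\<kappa> p q = ?\<kappa> p' q'" for p q p' q'
  proof -
    have fl: "\<lfloor>p j\<rfloor> = \<lfloor>p' j\<rfloor> \<and> \<lfloor>q j\<rfloor> = \<lfloor>q' j\<rfloor>" for j
    proof -
      have "prod_encode (j, prod_encode (int_encode \<lfloor>p j\<rfloor>, int_encode \<lfloor>q j\<rfloor>)) \<in> ?\<kappa> p' q'"
        unfolding that(5)[symmetric] by blast
      then show ?thesis by (auto simp: prod_encode_eq int_encode_eq)
    qed
    have "r = r'" if r: "r \<in> codes" "r' \<in> codes" and eq: "\<And>j. \<lfloor>r j\<rfloor> = \<lfloor>r' j\<rfloor>" for r r'
    proof
      fix j
      obtain k l where "r j = of_int k" "r' j = of_int l"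
        using codes_Ints[OF r(1), of j] codes_Ints[OF r(2), of j]
        by (auto elim!: Ints_cases)
      then show "r j = r' j" using eq[of j] by simp
    qed
    then show ?thesis using that(1-4) fl by blast
  qed
  let ?\<Gamma> = "\<lambda>f. (\<lambda>p. ?\<kappa> p (f p)) ` topspace X"
  have "inj_on ?\<Gamma> ?E"
  proof (rule inj_onI)
    fix f g assume f: "f \<in> ?E" and g: "g \<in> ?E" and eq: "?\<Gamma> f = ?\<Gamma> g"
    have top: "f \<in> topspace (selfmaps X)" "g \<in> topspace (selfmaps X)"
      using f g enveloping_semigroup_subset by blast+
    show "f = g"
    proof (rule extensionalityI[of f "topspace X"])
      show "f \<in> extensional (topspace X)" "g \<in> extensional (topspace X)"
        using top by (auto simp: PiE_def)
      fix p assume p: "p \<in> topspace X"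
      then have "?\<kappa> p (f p) \<in> ?\<Gamma> g" using eq by blast
      then obtain q where q: "q \<in> topspace X" "?\<kappa> p (f p) = ?\<kappa> q (g q)" by blast
      have "p = q \<and> f p = g q"
        by (rule \<kappa>) (use p q codes selfmaps_apply[OF top(1) p] selfmaps_apply[OF top(2) q(1)] in blast)+
      then show "f p = g p" by auto
    qed
  qed
  then have "?E \<lesssim> (UNIV :: nat set set set)"
    unfolding lepoll_def by (intro exI[of _ ?\<Gamma>] conjI subset_UNIV)
  moreover have "{I. minimal_left_ideal X T I} \<lesssim> ?E"
  proof -
    have ex: "\<exists>p. p \<in> I \<and> p \<in> ?E" if "minimal_left_ideal X T I" for I
    proof -
      have "I \<noteq> {}" "I \<subseteq> ?E" using that by (simp_all add: minimal_left_ideal_def left_ideal_def)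
      then show ?thesis by blast
    qed
    define h where "h I = (SOME p. p \<in> I \<and> p \<in> ?E)" for I
    have h: "h I \<in> I \<and> h I \<in> ?E" if "minimal_left_ideal X T I" for I
      unfolding h_def by (rule someI_ex[OF ex[OF that]])
    have "inj_on h {I. minimal_left_ideal X T I}"
    proof (rule inj_onI)
      fix I J assume IJ: "I \<in> {I. minimal_left_ideal X T I}" "J \<in> {I. minimal_left_ideal X T I}"
        and eq: "h I = h J"
      have "I = (\<lambda>q. compose (topspace X) q (h I)) ` ?E"
        by (rule minimal_left_ideal_principal[OF X]) (use IJ(1) h in simp_all)
      moreover have "J = (\<lambda>q. compose (topspace X) q (h J)) ` ?E"
        by (rule minimal_left_ideal_principal[OF X]) (use IJ(2) h in simp_all)
      ultimately show "I = J" using eq by simp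
    qed
    moreover have "h ` {I. minimal_left_ideal X T I} \<subseteq> ?E" using h by auto
    ultimately show ?thesis unfolding lepoll_def by (intro exI[of _ h] conjI)
  qed
  ultimately show ?thesis by (rule lepoll_trans[rotated])
qed

theorem theorem5p3:
  "\<exists>(X :: point topology) (T :: point \<Rightarrow> point).
     compact_space X \<and> metrizable_space X \<and> homeomorphic_map X X T \<and>
     minimal_cascade X T \<and> PI_of_order 3 X T \<and>
     {I. minimal_left_ideal X T I} \<approx> Pow (Pow (UNIV :: nat set))"
proof -
  let ?X = "top_of_set (coded Xrel)"
  have X: "cascade ?X (act 1)" by (rule cascade_act[OF invariant_X closed_X])
  have "topspace ?X \<subseteq> codes" using coded_codes by auto
  from lepoll_antisym[OF minimal_left_ideals_lepoll[OF X this] lepoll_minimal_left_ideals]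
  have "{I. minimal_left_ideal ?X (act 1) I} \<approx> Pow (Pow (UNIV :: nat set))" by simp
  moreover have "compact_space ?X" "homeomorphic_map ?X ?X (act 1)"
    using X by (simp_all add: cascade_def)
  ultimately show ?thesis
    using metrizable_top_of_set[of "coded Xrel"] minimal_X PI_of_order_3 by blast
qed

end
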